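(* There exists a left-computable real number $x$ which is nearly computable but not regainingly approximable.
   Context: A real number is left-computable if there is a computable non-decreasing sequence of rational numbers converging to it. A real $x$ is regainingly approximable if there is a computable non-decreasing sequence of rationals $(x_n)_n$ converging to $x$ with $x - x_n < 2^{-n}$ for infinitely many $n\in\mathbb{N}$. A function $f:\mathbb{N}\to\mathbb{N}$ is a modulus of convergence of a convergent sequence $(y_n)_n$ with limit $y$ if for all $n$ and all $m\ge f(n)$ we have $|y-y_m|<2^{-n}$; $(y_n)_n$ converges computably if it has a computable modulus of convergence. A sequence $(x_n)_n$ converges nearly computably if it converges and for every computable increasing function $s:\mathbb{N}\to\mathbb{N}$ the sequence $(x_{s(n+1)}-x_{s(n)})_n$ converges computably to $0$. A real is nearly computable if some computable sequence of rationals converges nearly computably to it. *)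

theory Defs
  imports Complex_Main
begin

datatype recf =
    Zero
  | Succ
  | Proj nat
  | Comp recf "recf list"
  | Prim recf recf
  | Mn recf

inductive rec_eval :: "recf \<Rightarrow> nat list \<Rightarrow> nat \<Rightarrow> bool" where
  eval_Zero: "rec_eval Zero xs 0"
| eval_Succ: "rec_eval Succ (x # xs) (Suc x)"
| eval_Proj: "i < length xs \<Longrightarrow> rec_eval (Proj i) xs (xs ! i)"
| eval_Comp: "list_all2 (\<lambda>g y. rec_eval g xs y) gs ys \<Longrightarrow> rec_eval f ys z
      \<Longrightarrow> rec_eval (Comp f gs) xs z"
| eval_Prim0: "rec_eval f xs z \<Longrightarrow> rec_eval (Prim f g) (0 # xs) z"
| eval_PrimS: "rec_eval (Prim f g) (n # xs) y \<Longrightarrow> rec_eval g (y # n # xs) z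
      \<Longrightarrow> rec_eval (Prim f g) (Suc n # xs) z"
| eval_Mn: "rec_eval f (n # xs) 0 \<Longrightarrow> (\<forall>m<n. \<exists>y. 0 < y \<and> rec_eval f (m # xs) y)
      \<Longrightarrow> rec_eval (Mn f) xs n"

definition computable :: "(nat \<Rightarrow> nat) \<Rightarrow> bool" where
  "computable g \<longleftrightarrow> (\<exists>f. \<forall>n. rec_eval f [n] (g n))"

definition computable_rat_seq :: "(nat \<Rightarrow> rat) \<Rightarrow> bool" where
  "computable_rat_seq q \<longleftrightarrow> (\<exists>a b c. computable a \<and> computable b \<and> computable c \<and>
      (\<forall>n. q n = (of_nat (a n) - of_nat (b n)) / of_nat (Suc (c n))))"

definition left_computable :: "real \<Rightarrow> bool" where
  "left_computable x \<longleftrightarrow> (\<exists>q. computable_rat_seq q \<and> mono q \<and>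
      (\<lambda>n. real_of_rat (q n)) \<longlonglongrightarrow> x)"

definition regainingly_approximable :: "real \<Rightarrow> bool" where
  "regainingly_approximable x \<longleftrightarrow> (\<exists>q. computable_rat_seq q \<and> mono q \<and>
      (\<lambda>n. real_of_rat (q n)) \<longlonglongrightarrow> x \<and>
      infinite {n. x - real_of_rat (q n) < 1 / 2 ^ n})"

definition is_modulus :: "(nat \<Rightarrow> real) \<Rightarrow> real \<Rightarrow> (nat \<Rightarrow> nat) \<Rightarrow> bool" where
  "is_modulus y l f \<longleftrightarrow> (\<forall>n. \<forall>m \<ge> f n. \<bar>l - y m\<bar> < 1 / 2 ^ n)"

definition converges_computably_to :: "(nat \<Rightarrow> real) \<Rightarrow> real \<Rightarrow> bool" where
  "converges_computably_to y l \<longleftrightarrow> y \<longlonglongrightarrow> l \<and> (\<exists>f. computable f \<and> is_modulus y l f)"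

definition converges_nearly_computably :: "(nat \<Rightarrow> real) \<Rightarrow> bool" where
  "converges_nearly_computably x \<longleftrightarrow> convergent x \<and>
     (\<forall>s. computable s \<and> strict_mono s \<longrightarrow>
        converges_computably_to (\<lambda>n. x (s (Suc n)) - x (s n)) 0)"

definition nearly_computable :: "real \<Rightarrow> bool" where
  "nearly_computable x \<longleftrightarrow> (\<exists>q. computable_rat_seq q \<and>
      (\<lambda>n. real_of_rat (q n)) \<longlonglongrightarrow> x \<and>
      converges_nearly_computably (\<lambda>n. real_of_rat (q n)))"

end

theory Submission
  imports Defs "HOL-Library.Nat_Bijection" "HOL-Analysis.Analysis" "HOL-Real_Asymp.Real_Asymp"
begin

text \<open>
  An infinite-injury construction. Let \<open>L i t\<close> be the length of convergence of the \<open>i\<close>-th partial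
  recursive function at time \<open>t\<close>. A binary tree guesses for every \<open>i\<close> whether \<open>L i\<close> is unbounded. At each
  time \<open>t\<close> one node is visited, nodes to its right are cancelled, and the visited node creates mass
  \<open>2\<^sup>-\<^sup>t\<^sup>-\<^sup>1\<close>, which is activated at its next visit. Active mass travels from a node to its parent and
  finally leaves the root; the real \<open>x\<close> is the total mass that has left the root.

  A node passes mass on only at \<^emph>\<open>effective\<close> visits, when its proper ancestors together hold at most
  \<open>1 / (k + 1)\<close>, and then passes on at most \<open>1 / (k + 1)\<close>, where \<open>k\<close> counts the earlier effective visits.
  Hence between two effective visits of a node on the true path \<open>x\<close> grows by \<open>O(1 / k)\<close>; if the node
  guesses that \<open>s\<close> is total, effective visits can be awaited computably and are sparser than the
  values of \<open>s\<close>, so \<open>x\<close> is nearly computable. As the harmonic series diverges, all mass on the true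
  path reaches \<open>x\<close>; so for every total computable \<open>f\<close> and almost all \<open>n\<close>, at least \<open>2 \<cdot> 2\<^sup>-\<^sup>n\<close> is added
  after time \<open>f n\<close>, which refutes regaining approximations.
\<close>

section \<open>A calculus of recursive functions\<close>

text \<open>
  Functions take an environment of variables instead of an argument list. The program must work on
  every sufficiently long initial segment of the environment, so arities need not be tracked; bound
  variables of sums, quantifiers and recursions are pushed in front as variable 0, as de Bruijn indices.
\<close>

definition recursive :: "((nat \<Rightarrow> nat) \<Rightarrow> nat) \<Rightarrow> bool" where
  "recursive F \<longleftrightarrow> (\<exists>f k. \<forall>e k'. k \<le> k' \<longrightarrow> rec_eval f (map e [0..<k']) (F e))"

definition decidable :: "((nat \<Rightarrow> nat) \<Rightarrow> bool) \<Rightarrow> bool" where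
  "decidable P \<longleftrightarrow> recursive (\<lambda>e. if P e then 1 else 0)"

named_theorems rec_intros

lemma recursive_var [rec_intros]: "recursive (\<lambda>e. e c)"
  unfolding recursive_def
proof (intro exI[of _ "Proj c"] exI[of _ "Suc c"] allI impI)
  fix e :: "nat \<Rightarrow> nat" and k' assume "Suc c \<le> k'"
  then show "rec_eval (Proj c) (map e [0..<k']) (e c)"
    using eval_Proj[of c "map e [0..<k']"] by simp
qed

text \<open>The program of \<open>F\<close> looks only at the first \<open>k\<close> variables, so
  it is composed with finitely many programs for the \<open>G i\<close>; the family is thus required
  to be recursive only one index at a time.\<close>

lemma recursive_subst:
  assumes F: "recursive F" and G: "\<And>i. recursive (G i)"
  shows "recursive (\<lambda>e. F (\<lambda>i. G i e))"
proof -
  obtain f k where f: "\<And>e k'. k \<le> k' \<Longrightarrow> rec_eval f (map e [0..<k']) (F e)"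
    using F unfolding recursive_def by blast
  have "\<forall>i. \<exists>g kg. \<forall>e k'. kg \<le> k' \<longrightarrow> rec_eval g (map e [0..<k']) (G i e)"
    using G unfolding recursive_def by blast
  then obtain g kg where g: "\<And>i e k'. kg i \<le> k' \<Longrightarrow> rec_eval (g i) (map e [0..<k']) (G i e)"
    by metis
  define K where "K = (\<Sum>i<k. kg i)"
  have K: "kg i \<le> K" if "i < k" for i
    unfolding K_def using that by (intro member_le_sum) auto
  have "rec_eval (Comp f (map g [0..<k])) (map e [0..<k']) (F (\<lambda>i. G i e))" if "K \<le> k'" for e k'
  proof (rule eval_Comp)
    show "list_all2 (\<lambda>g y. rec_eval g (map e [0..<k']) y) (map g [0..<k]) (map (\<lambda>i. G i e) [0..<k])"
      using that K by (auto simp: list_all2_conv_all_nth intro!: g order_trans[OF K])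
    show "rec_eval f (map (\<lambda>i. G i e) [0..<k]) (F (\<lambda>i. G i e))"
      by (rule f) simp
  qed
  then show ?thesis unfolding recursive_def by blast
qed

lemma recursive_comp1:
  assumes "recursive (\<lambda>e. f (e 0))" "recursive A"
  shows "recursive (\<lambda>e. f (A e))"
  using recursive_subst[OF assms(1), of "\<lambda>_. A"] assms(2) by simp

lemma recursive_comp2:
  assumes "recursive (\<lambda>e. f (e 0) (e 1))" "recursive A" "recursive B"
  shows "recursive (\<lambda>e. f (A e) (B e))"
  using recursive_subst[OF assms(1), of "\<lambda>i. if i = 0 then A else B"] assms(2,3) by simp

lemma recursive_comp3:
  assumes "recursive (\<lambda>e. f (e 0) (e 1) (e 2))" "recursive A" "recursive B" "recursive D"
  shows "recursive (\<lambda>e. f (A e) (B e) (D e))"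
  using recursive_subst[OF assms(1), of "\<lambda>i. if i = 0 then A else if i = 1 then B else D"] assms(2-4)
  by simp

lemma recursive_Suc [rec_intros]: "recursive A \<Longrightarrow> recursive (\<lambda>e. Suc (A e))"
proof (rule recursive_comp1[where f = Suc])
  have "rec_eval Succ (map e [0..<k']) (Suc (e 0))" if "1 \<le> k'" for e :: "nat \<Rightarrow> nat" and k'
    using eval_Succ[of "e 0" "map e [1..<k']"] that by (simp add: upt_conv_Cons)
  then show "recursive (\<lambda>e. Suc (e 0))" unfolding recursive_def by blast
qed

lemma recursive_const [rec_intros]: "recursive (\<lambda>e. n)"
proof (induction n)
  case 0
  show ?case unfolding recursive_def using eval_Zero by blast
next
  case (Suc n)
  then show ?case by (rule recursive_Suc)
qed

lemma map_case_nat_upt: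
  "map (case_nat x e) [0..<Suc k] = x # map e [0..<k]"
  by (simp add: upt_conv_Cons map_Suc_upt[symmetric] comp_def del: upt_Suc)

text \<open>\<open>Prim\<close> calls its step with the previous value first and the counter second,
  hence variables 0 and 1 in the premise for \<open>G\<close>; the outer variables are shifted by
  two.\<close>

lemma recursive_rec_nat [rec_intros]:
  assumes N: "recursive N" and F: "recursive F"
    and G: "recursive (\<lambda>e. G (e 1) (e 0) (\<lambda>j. e (Suc (Suc j))))"
  shows "recursive (\<lambda>e. rec_nat (F e) (\<lambda>n y. G n y e) (N e))"
proof -
  obtain f kf where f: "\<And>e k'. kf \<le> k' \<Longrightarrow> rec_eval f (map e [0..<k']) (F e)"
    using F unfolding recursive_def by blast
  obtain g kg where g: "\<And>e k'. kg \<le> k' \<Longrightarrow>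
      rec_eval g (map e [0..<k']) (G (e 1) (e 0) (\<lambda>j. e (Suc (Suc j))))"
    using G unfolding recursive_def by blast
  obtain h kh where h: "\<And>e k'. kh \<le> k' \<Longrightarrow> rec_eval h (map e [0..<k']) (N e)"
    using N unfolding recursive_def by blast
  define K where "K = max kf kg"
  have P: "rec_eval (Prim f g) (n # map e [0..<K]) (rec_nat (F e) (\<lambda>n y. G n y e) n)" for n e
  proof (induction n)
    case 0
    show ?case by (simp add: eval_Prim0 f K_def)
  next
    case (Suc n)
    let ?y = "rec_nat (F e) (\<lambda>n y. G n y e) n"
    have "rec_eval g (map (case_nat ?y (case_nat n e)) [0..<Suc (Suc K)]) (G n ?y e)"
      using g[of "Suc (Suc K)" "case_nat ?y (case_nat n e)"] by (simp add: K_def del: upt_Suc)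
    then have "rec_eval g (?y # n # map e [0..<K]) (G n ?y e)"
      by (simp only: map_case_nat_upt)
    with Suc show ?case by (simp add: eval_PrimS)
  qed
  \<comment> \<open>\<open>Prim\<close> recurses on its first argument, so the value of
    \<open>N\<close> is put in front of copies of the variables.\<close>
  have "rec_eval (Comp (Prim f g) (h # map Proj [0..<K])) (map e [0..<k'])
          (rec_nat (F e) (\<lambda>n y. G n y e) (N e))" if "max kh K \<le> k'" for e k'
  proof (rule eval_Comp[OF _ P])
    have "rec_eval (Proj i) (map e [0..<k']) (e i)" if "i < K" for i
      using eval_Proj[of i "map e [0..<k']"] that \<open>max kh K \<le> k'\<close> by simp
    then show "list_all2 (\<lambda>g y. rec_eval g (map e [0..<k']) y) (h # map Proj [0..<K]) (N e # map e [0..<K])"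
      using h that by (auto simp: list_all2_conv_all_nth nth_Cons split: nat.split)
  qed
  then show ?thesis unfolding recursive_def by blast
qed

lemma recursive_Least:
  assumes F: "recursive (\<lambda>e. F (e 0) (\<lambda>j. e (Suc j)))" and ex: "\<And>e. \<exists>n. F n e = 0"
  shows "recursive (\<lambda>e. LEAST n. F n e = (0::nat))"
proof -
  obtain f kf where f: "\<And>e k'. kf \<le> k' \<Longrightarrow>
      rec_eval f (map e [0..<k']) (F (e 0) (\<lambda>j. e (Suc j)))"
    using F unfolding recursive_def by blast
  have f': "rec_eval f (n # map e [0..<k']) (F n e)" if "kf \<le> k'" for n e k'
    using f[of "Suc k'" "case_nat n e"] that by (simp add: map_case_nat_upt del: upt_Suc)
  have "rec_eval (Mn f) (map e [0..<k']) (LEAST n. F n e = 0)" if "kf \<le> k'" for e k'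
  proof (rule eval_Mn)
    show "rec_eval f ((LEAST n. F n e = 0) # map e [0..<k']) 0"
      using f'[OF that, of "LEAST n. F n e = 0" e] LeastI_ex[OF ex[of e]] by simp
    show "\<forall>m<LEAST n. F n e = 0. \<exists>y>0. rec_eval f (m # map e [0..<k']) y"
      using f'[OF that] not_less_Least by blast
  qed
  then show ?thesis unfolding recursive_def by blast
qed

lemma computable_iff_recursive: "computable g \<longleftrightarrow> recursive (\<lambda>e. g (e 0))"
proof
  assume "computable g"
  then obtain f where f: "\<And>n. rec_eval f [n] (g n)" unfolding computable_def by blast
  have "rec_eval (Comp f [Proj 0]) (map e [0..<k']) (g (e 0))" if "1 \<le> k'" for e :: "nat \<Rightarrow> nat" and k'
    using eval_Proj[of 0 "map e [0..<k']"] that by (intro eval_Comp[OF _ f]) auto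
  then show "recursive (\<lambda>e. g (e 0))" unfolding recursive_def by blast
next
  assume "recursive (\<lambda>e. g (e 0))"
  then obtain f k where f: "\<And>e k'. k \<le> k' \<Longrightarrow> rec_eval f (map e [0..<k']) (g (e 0))"
    unfolding recursive_def by blast
  \<comment> \<open>The program expects at least \<open>k\<close> arguments; duplicating the only
    input supplies a constant environment.\<close>
  have "rec_eval (Comp f (map (\<lambda>_. Proj 0) [0..<k])) [n] (g n)" for n
  proof (rule eval_Comp)
    show "list_all2 (\<lambda>g y. rec_eval g [n] y) (map (\<lambda>_. Proj 0) [0..<k]) (map (\<lambda>_. n) [0..<k])"
      using eval_Proj[of 0 "[n]"] by (auto simp: list_all2_conv_all_nth)
    show "rec_eval f (map (\<lambda>_. n) [0..<k]) (g n)" using f[of k "\<lambda>_. n"] by simp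
  qed
  then show "computable g" unfolding computable_def by blast
qed

lemma recursive_computable: "computable g \<Longrightarrow> recursive A \<Longrightarrow> recursive (\<lambda>e. g (A e))"
  using recursive_comp1 computable_iff_recursive by blast

lemma recursive_add [rec_intros]:
  assumes "recursive A" "recursive B" shows "recursive (\<lambda>e. A e + B e)"
proof -
  have eq: "a + b = rec_nat a (\<lambda>_ y. Suc y) b" for a b :: nat by (induction b) auto
  show ?thesis unfolding eq by (intro rec_intros assms)
qed

lemma recursive_mult [rec_intros]:
  assumes "recursive A" "recursive B" shows "recursive (\<lambda>e. A e * B e)"
proof -
  have eq: "a * b = rec_nat 0 (\<lambda>_ y. y + a) b" for a b :: nat by (induction b) auto
  have "recursive (\<lambda>e. rec_nat 0 (\<lambda>_ y. y + e 0) (e 1))"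
    by (intro rec_intros)
  from recursive_comp2[where f = "\<lambda>a b. rec_nat 0 (\<lambda>_ y. y + a) b", OF this assms]
  show ?thesis unfolding eq .
qed

lemma recursive_power [rec_intros]:
  assumes "recursive A" "recursive B" shows "recursive (\<lambda>e. A e ^ B e)"
proof -
  have eq: "a ^ b = rec_nat 1 (\<lambda>_ y. y * a) b" for a b :: nat by (induction b) auto
  have "recursive (\<lambda>e. rec_nat 1 (\<lambda>_ y. y * e 0) (e 1))"
    by (intro rec_intros)
  from recursive_comp2[where f = "\<lambda>a b. rec_nat 1 (\<lambda>_ y. y * a) b", OF this assms]
  show ?thesis unfolding eq .
qed

lemma recursive_diff [rec_intros]:
  assumes "recursive A" "recursive B" shows "recursive (\<lambda>e. A e - B e)"
proof -
  have eq1: "a - 1 = rec_nat 0 (\<lambda>n _. n) a" for a :: nat by (induction a) auto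
  have eq: "a - b = rec_nat a (\<lambda>_ y. rec_nat 0 (\<lambda>n _. n) y) b" for a b :: nat
    by (induction b) (auto simp flip: eq1)
  have "recursive (\<lambda>e. rec_nat 0 (\<lambda>n _. n) (e 0))"
    by (intro rec_intros)
  note pr = recursive_comp1[where f = "rec_nat 0 (\<lambda>n _. n)", OF this]
  have "recursive (\<lambda>e. rec_nat (e 0) (\<lambda>_ y. rec_nat 0 (\<lambda>n _. n) y) (e 1))"
    by (intro pr recursive_rec_nat[where G = "\<lambda>_ y _. rec_nat 0 (\<lambda>n _. n) y"] recursive_var)
  from recursive_comp2[where f = "\<lambda>a b. rec_nat a (\<lambda>_ y. rec_nat 0 (\<lambda>n _. n) y) b", OF this assms]
  show ?thesis unfolding eq .
qed

lemma recursive_if [rec_intros]: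
  assumes "decidable P" "recursive A" "recursive B"
  shows "recursive (\<lambda>e. if P e then A e else B e)"
proof -
  have eq: "(if P e then A e else B e) =
    (if P e then 1 else 0) * A e + (1 - (if P e then 1 else 0)) * B e" for e by simp
  show ?thesis unfolding eq using assms unfolding decidable_def by (intro rec_intros)
qed

lemma decidable_le [rec_intros]:
  assumes "recursive A" "recursive B" shows "decidable (\<lambda>e. A e \<le> B e)"
proof -
  have eq: "(if A e \<le> B e then 1 else 0) = 1 - (A e - B e)" for e by simp
  show ?thesis unfolding decidable_def eq by (intro rec_intros assms)
qed

lemma recursive_min [rec_intros]:
  "recursive A \<Longrightarrow> recursive B \<Longrightarrow> recursive (\<lambda>e. min (A e) (B e))"
  unfolding min_def by (intro rec_intros)

lemma decidable_less [rec_intros]: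
  assumes "recursive A" "recursive B" shows "decidable (\<lambda>e. A e < B e)"
  unfolding less_eq_Suc_le by (intro rec_intros assms)

lemma decidable_not [rec_intros]:
  assumes "decidable P" shows "decidable (\<lambda>e. \<not> P e)"
proof -
  have eq: "(if \<not> P e then 1 else 0) = 1 - (if P e then 1 else (0::nat))" for e by simp
  show ?thesis using assms unfolding decidable_def eq by (intro recursive_diff recursive_const)
qed

lemma decidable_conj [rec_intros]:
  assumes "decidable P" "decidable Q" shows "decidable (\<lambda>e. P e \<and> Q e)"
proof -
  have eq: "(if P e \<and> Q e then 1 else 0) = (if P e then 1 else 0) * (if Q e then 1 else (0::nat))" for e by simp
  show ?thesis using assms unfolding decidable_def eq by (intro recursive_mult)
qed

lemma decidable_disj [rec_intros]:
  assumes "decidable P" "decidable Q" shows "decidable (\<lambda>e. P e \<or> Q e)"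
proof -
  have "decidable (\<lambda>e. \<not> (\<not> P e \<and> \<not> Q e))" by (intro decidable_not decidable_conj assms)
  then show ?thesis by simp
qed

lemma decidable_imp [rec_intros]:
  assumes "decidable P" "decidable Q" shows "decidable (\<lambda>e. P e \<longrightarrow> Q e)"
  unfolding imp_conv_disj by (intro rec_intros assms)

lemma decidable_eq [rec_intros]:
  assumes "recursive A" "recursive B" shows "decidable (\<lambda>e. A e = B e)"
  unfolding order_eq_iff by (intro rec_intros assms)

lemma recursive_sum [rec_intros]:
  assumes "recursive N" "recursive (\<lambda>e. F (e 0) (\<lambda>j. e (Suc j)))"
  shows "recursive (\<lambda>e. \<Sum>i<N e. F i e)"
proof -
  have eq: "(\<Sum>i<n. f i) = rec_nat 0 (\<lambda>n y. y + f n) n" for n and f :: "nat \<Rightarrow> nat"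
    by (induction n) auto
  have "recursive (\<lambda>e. e 0 + F (e 1) (\<lambda>j. e (Suc (Suc j))))"
    using recursive_subst[OF assms(2), of "\<lambda>i. \<lambda>e. e (Suc i)"]
    by (intro rec_intros) (auto simp: recursive_var)
  from recursive_rec_nat[where G = "\<lambda>n y e. y + F n e", OF assms(1) recursive_const[of 0] this]
  show ?thesis unfolding eq .
qed

lemma decidable_Ex [rec_intros]:
  assumes "recursive N" "decidable (\<lambda>e. P (e 0) (\<lambda>j. e (Suc j)))"
  shows "decidable (\<lambda>e. \<exists>i<N e. P i e)"
proof -
  have eq: "(\<exists>i<N e. P i e) \<longleftrightarrow> 0 < (\<Sum>i<N e. if P i e then 1 else (0::nat))" for e
    by (subst neq0_conv[symmetric], subst sum_eq_0_iff) auto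
  show ?thesis unfolding eq using assms unfolding decidable_def[of "\<lambda>e. P (e 0) (\<lambda>j. e (Suc j))"]
    by (intro decidable_less recursive_const recursive_sum)
qed

lemma decidable_All [rec_intros]:
  assumes "recursive N" "decidable (\<lambda>e. P (e 0) (\<lambda>j. e (Suc j)))"
  shows "decidable (\<lambda>e. \<forall>i<N e. P i e)"
proof -
  have "decidable (\<lambda>e. \<not> (\<exists>i<N e. \<not> P i e))" by (intro rec_intros assms)
  then show ?thesis by simp
qed

lemma recursive_Least_decidable:
  assumes "decidable (\<lambda>e. P (e 0) (\<lambda>j. e (Suc j)))" "\<And>e. \<exists>n. P n e"
  shows "recursive (\<lambda>e. LEAST n. P n e)"
proof -
  have eq: "P n e \<longleftrightarrow> (if \<not> P n e then 1 else (0::nat)) = 0" for n e by simp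
  show ?thesis
    by (subst eq, intro recursive_Least rec_intros assms) (use assms(2) in auto)
qed

text \<open>The quotient counts the positive multiples of the divisor up to the dividend; division
  by 0 yields 0 and is treated apart.\<close>

lemma recursive_div [rec_intros]:
  assumes "recursive A" "recursive B" shows "recursive (\<lambda>e. A e div B e)"
proof -
  have eq: "a div b = (if b = 0 then 0 else \<Sum>i<a. if Suc i * b \<le> a then 1 else 0)" for a b :: nat
  proof (cases "b = 0")
    case False
    have "i < a \<and> Suc i * b \<le> a \<longleftrightarrow> i < a div b" for i
    proof -
      have "Suc i * b \<le> a \<longleftrightarrow> i < a div b"
        using False less_eq_div_iff_mult_less_eq[of b "Suc i" a] by (simp del: mult_Suc add: Suc_le_eq)
      then show ?thesis using div_le_dividend[of a b] by linarith
    qed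
    then have "{i. i < a \<and> Suc i * b \<le> a} = {..<a div b}" by auto
    moreover have "(\<Sum>i<a. if Suc i * b \<le> a then 1 else 0) = card {i. i < a \<and> Suc i * b \<le> a}"
      by (simp add: sum.If_cases Int_def)
    ultimately show ?thesis using False by simp
  qed auto
  have "recursive (\<lambda>e. if e 1 = 0 then 0 else \<Sum>i<e 0. if Suc i * e 1 \<le> e 0 then 1 else 0)"
    by (intro rec_intros)
  then have "recursive (\<lambda>e. e 0 div e 1)" by (simp only: eq)
  from recursive_comp2[where f = "(div)", OF this assms] show ?thesis .
qed

lemma decidable_odd [rec_intros]:
  assumes "recursive A" shows "decidable (\<lambda>e. odd (A e))"
proof -
  have eq: "odd n \<longleftrightarrow> n \<noteq> 2 * (n div 2)" for n :: nat by presburger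
  show ?thesis unfolding eq by (intro rec_intros assms)
qed

lemma decidable_even [rec_intros]:
  assumes "recursive A" shows "decidable (\<lambda>e. even (A e))"
  using decidable_not[OF decidable_odd[OF assms]] by simp

lemma recursive_prod_encode [rec_intros]:
  assumes "recursive A" "recursive B" shows "recursive (\<lambda>e. prod_encode (A e, B e))"
  unfolding prod_encode_def triangle_def by (simp, intro rec_intros assms)

text \<open>Both components are bounded by the code, so a double sum over all candidate pairs
  selects the right one.\<close>

lemma recursive_fst_prod_decode [rec_intros]:
  assumes "recursive A" shows "recursive (\<lambda>e. fst (prod_decode (A e)))"
proof -
  have "(\<Sum>a<Suc z. \<Sum>b<Suc z. if prod_encode (a, b) = z then a else 0) = fst (prod_decode z)" for z
  proof -
    obtain a b where z: "z = prod_encode (a, b)" by (metis prod_decode_inverse surj_pair)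
    have le: "a < Suc z" "b < Suc z" using z le_prod_encode_1 le_prod_encode_2 by (auto simp: less_Suc_eq_le)
    have "(\<Sum>a'<Suc z. \<Sum>b'<Suc z. if prod_encode (a', b') = z then a' else 0)
        = (\<Sum>a'<Suc z. if a' = a then (\<Sum>b'<Suc z. if b' = b then a' else 0) else 0)"
      by (intro sum.cong refl) (auto simp: z prod_encode_eq)
    also have "\<dots> = a" using le by simp
    finally show ?thesis using z by simp
  qed
  moreover have "recursive (\<lambda>e. (\<Sum>a<Suc (e 0). \<Sum>b<Suc (e 0). if prod_encode (a, b) = e 0 then a else 0))"
    by (intro rec_intros)
  ultimately have "recursive (\<lambda>e. fst (prod_decode (e 0)))" by simp
  from recursive_comp1[OF this assms] show ?thesis by simp
qed

lemma recursive_snd_prod_decode [rec_intros]: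
  assumes "recursive A" shows "recursive (\<lambda>e. snd (prod_decode (A e)))"
proof -
  have "(\<Sum>a<Suc z. \<Sum>b<Suc z. if prod_encode (a, b) = z then b else 0) = snd (prod_decode z)" for z
  proof -
    obtain a b where z: "z = prod_encode (a, b)" by (metis prod_decode_inverse surj_pair)
    have le: "a < Suc z" "b < Suc z" using z le_prod_encode_1 le_prod_encode_2 by (auto simp: less_Suc_eq_le)
    have "(\<Sum>a'<Suc z. \<Sum>b'<Suc z. if prod_encode (a', b') = z then b' else 0)
        = (\<Sum>a'<Suc z. if a' = a then (\<Sum>b'<Suc z. if b' = b then b' else 0) else 0)"
      by (intro sum.cong refl) (auto simp: z prod_encode_eq)
    also have "\<dots> = b" using le by simp
    finally show ?thesis using z by simp
  qed
  moreover have "recursive (\<lambda>e. (\<Sum>a<Suc (e 0). \<Sum>b<Suc (e 0). if prod_encode (a, b) = e 0 then b else 0))"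
    by (intro rec_intros)
  ultimately have "recursive (\<lambda>e. snd (prod_decode (e 0)))" by simp
  from recursive_comp1[OF this assms] show ?thesis by simp
qed

section \<open>A universal length of convergence\<close>

primrec code :: "recf \<Rightarrow> nat" where
  "code Zero = prod_encode (0, 0)"
| "code Succ = prod_encode (Suc 0, 0)"
| "code (Proj i) = prod_encode (2, i)"
| "code (Comp f gs) = prod_encode (3, prod_encode (code f, list_encode (map code gs)))"
| "code (Prim f g) = prod_encode (4, prod_encode (code f, code g))"
| "code (Mn f) = prod_encode (5, code f)"

definition lcons :: "nat \<Rightarrow> nat \<Rightarrow> nat" where
  "lcons x s = Suc (prod_encode (x, s))"

definition stmt :: "nat \<Rightarrow> nat \<Rightarrow> nat \<Rightarrow> nat \<Rightarrow> nat" where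
  "stmt k a b c = prod_encode (k, prod_encode (a, prod_encode (b, c)))"

text \<open>\<open>stmt 0 f xs y\<close> asserts that the function coded by \<open>f\<close> maps the coded list \<open>xs\<close> to \<open>y\<close>;
  \<open>stmt (Suc 0) gs xs ys\<close> asserts this componentwise for coded lists \<open>gs\<close> and \<open>ys\<close>.\<close>

inductive justified :: "nat set \<Rightarrow> nat \<Rightarrow> nat \<Rightarrow> nat \<Rightarrow> nat \<Rightarrow> bool" for X where
  Zero: "justified X 0 (prod_encode (0, 0)) b 0"
| Succ: "justified X 0 (prod_encode (Suc 0, 0)) (lcons x r) (Suc x)"
| Proj0: "justified X 0 (prod_encode (2, 0)) (lcons x r) x"
| ProjS: "stmt 0 (prod_encode (2, i)) r c \<in> X \<Longrightarrow>
    justified X 0 (prod_encode (2, Suc i)) (lcons x r) c"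
| Comp: "stmt (Suc 0) gs b ys \<in> X \<Longrightarrow> stmt 0 f ys c \<in> X \<Longrightarrow>
    justified X 0 (prod_encode (3, prod_encode (f, gs))) b c"
| Prim0: "stmt 0 f r c \<in> X \<Longrightarrow>
    justified X 0 (prod_encode (4, prod_encode (f, g))) (lcons 0 r) c"
| PrimS: "stmt 0 (prod_encode (4, prod_encode (f, g))) (lcons n r) y \<in> X \<Longrightarrow>
    stmt 0 g (lcons y (lcons n r)) c \<in> X \<Longrightarrow>
    justified X 0 (prod_encode (4, prod_encode (f, g))) (lcons (Suc n) r) c"
| Mn: "stmt 0 f (lcons c b) 0 \<in> X \<Longrightarrow> (\<forall>m<c. \<exists>y>0. stmt 0 f (lcons m b) y \<in> X) \<Longrightarrow>
    justified X 0 (prod_encode (5, f)) b c"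
| Nil: "justified X (Suc 0) 0 b 0"
| Cons: "stmt 0 g b y \<in> X \<Longrightarrow> stmt (Suc 0) gs b ys \<in> X \<Longrightarrow>
    justified X (Suc 0) (lcons g gs) b (lcons y ys)"

text \<open>
  No well-founded order on the statements is required: justification follows the structure of the
  program and the recursion argument, so self-justified sets are sound by induction on these.
\<close>

definition self_justified :: "nat set \<Rightarrow> bool" where
  "self_justified X \<longleftrightarrow> (\<forall>k a b c. stmt k a b c \<in> X \<longrightarrow> justified X k a b c)"

lemma stmt_inject [simp]: "stmt k a b c = stmt k' a' b' c' \<longleftrightarrow> k = k' \<and> a = a' \<and> b = b' \<and> c = c'"
  by (auto simp: stmt_def prod_encode_eq)

lemma lcons_inject [simp]: "lcons x r = lcons x' r' \<longleftrightarrow> x = x' \<and> r = r'"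
  by (auto simp: lcons_def prod_encode_eq)

lemma lcons_neq_0 [simp]: "lcons x r \<noteq> 0" "0 \<noteq> lcons x r"
  by (auto simp: lcons_def)

lemma list_encode_Cons_lcons: "list_encode (x # xs) = lcons x (list_encode xs)"
  by (simp add: lcons_def)

lemma list_encode_eq_lconsE:
  assumes "list_encode xs = lcons x r"
  obtains xs' where "xs = x # xs'" "r = list_encode xs'"
  using assms by (cases xs) (auto simp: lcons_def prod_encode_eq)

lemma justified_mono: "justified X k a b c \<Longrightarrow> X \<subseteq> Y \<Longrightarrow> justified Y k a b c"
  by (induction rule: justified.induct; rule justified.intros; blast)

lemma self_justified_Un: "self_justified X \<Longrightarrow> self_justified Y \<Longrightarrow> self_justified (X \<union> Y)"
  unfolding self_justified_def by (meson UnE justified_mono Un_upper1 Un_upper2)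

lemma self_justified_UN:
  "(\<And>i. i \<in> I \<Longrightarrow> self_justified (X i)) \<Longrightarrow> self_justified (\<Union>i\<in>I. X i)"
  unfolding self_justified_def by (meson UN_E UN_upper justified_mono)

lemma self_justified_insert:
  "self_justified X \<Longrightarrow> justified X k a b c \<Longrightarrow> self_justified (insert (stmt k a b c) X)"
  unfolding self_justified_def
  by (auto intro: justified_mono[OF _ subset_insertI])

lemma self_justifiedD: "self_justified X \<Longrightarrow> stmt k a b c \<in> X \<Longrightarrow> justified X k a b c"
  unfolding self_justified_def by blast

text \<open>Soundness of the components is a hypothesis here, so that the \<open>Comp\<close> case
  of the induction over programs can supply its induction hypothesis.\<close>

lemma self_justified_args_sound:
  assumes X: "self_justified X" and stmt: "stmt (Suc 0) (list_encode (map code gs)) b c \<in> X"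
    and IH: "\<And>g y. g \<in> set gs \<Longrightarrow> stmt 0 (code g) b y \<in> X \<Longrightarrow> rec_eval g xs y"
  shows "\<exists>ys. c = list_encode ys \<and> list_all2 (\<lambda>g y. rec_eval g xs y) gs ys"
  using stmt IH
proof (induction gs arbitrary: c)
  case Nil
  then have "justified X (Suc 0) 0 b c" using X by (auto simp: self_justified_def)
  then have "c = 0" by cases auto
  then show ?case by (intro exI[of _ "[]"]) simp
next
  case (Cons g gs)
  from Cons.prems(1) have "justified X (Suc 0) (lcons (code g) (list_encode (map code gs))) b c"
    unfolding list.map list_encode_Cons_lcons by (rule self_justifiedD[OF X])
  then obtain y ys where c: "c = lcons y ys" "stmt 0 (code g) b y \<in> X"
    "stmt (Suc 0) (list_encode (map code gs)) b ys \<in> X"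
    by cases auto
  then obtain ys' where "ys = list_encode ys'" "list_all2 (\<lambda>g y. rec_eval g xs y) gs ys'"
    using Cons.IH[OF c(3)] Cons.prems(2) by auto
  moreover have "rec_eval g xs y" using Cons.prems(2)[of g y] c(2) by simp
  ultimately show ?case using c(1)
    by (intro exI[of _ "y # ys'"]) (simp add: list_encode_Cons_lcons del: list_encode.simps)
qed

lemma self_justified_sound:
  assumes X: "self_justified X"
  shows "stmt 0 (code f) (list_encode xs) y \<in> X \<Longrightarrow> rec_eval f xs y"
proof (induction f arbitrary: xs y)
  case Zero
  from Zero.prems have "justified X 0 (code Zero) (list_encode xs) y" by (rule self_justifiedD[OF X])
  then show ?case by cases (auto simp: prod_encode_eq intro: rec_eval.intros)
next
  case Succ
  from Succ.prems have "justified X 0 (code Succ) (list_encode xs) y" by (rule self_justifiedD[OF X])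
  then obtain x r where x: "list_encode xs = lcons x r" "y = Suc x" by cases (auto simp: prod_encode_eq)
  then obtain xs' where "xs = x # xs'" by (auto elim: list_encode_eq_lconsE)
  then show ?case using x(2) eval_Succ by simp
next
  case (Proj i)
  from Proj.prems show ?case
  proof (induction i arbitrary: xs)
    case 0
    from 0 have "justified X 0 (code (Proj 0)) (list_encode xs) y" by (rule self_justifiedD[OF X])
    then obtain r where "list_encode xs = lcons y r" by cases (auto simp: prod_encode_eq)
    then obtain xs' where "xs = y # xs'" by (rule list_encode_eq_lconsE)
    then show ?case using eval_Proj[of 0 xs] by simp
  next
    case (Suc i)
    from Suc.prems have "justified X 0 (code (Proj (Suc i))) (list_encode xs) y" by (rule self_justifiedD[OF X])
    then show ?case
    proof cases
      case (ProjS i' r x)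
      then have "list_encode xs = lcons x r" and i: "stmt 0 (code (Proj i)) r y \<in> X"
        by (auto simp: prod_encode_eq)
      then obtain xs' where xs: "xs = x # xs'" "r = list_encode xs'" by (auto elim: list_encode_eq_lconsE)
      have "rec_eval (Proj i) xs' y" by (rule Suc.IH) (use i xs in simp)
      then show ?thesis
        using eval_Proj[of "Suc i" xs] xs by cases auto
    qed (auto simp: prod_encode_eq)
  qed
next
  case (Comp f gs)
  from Comp.prems have "justified X 0 (code (Comp f gs)) (list_encode xs) y" by (rule self_justifiedD[OF X])
  then show ?case
  proof cases
    case (Comp gs' ys f')
    then have g: "stmt (Suc 0) (list_encode (map code gs)) (list_encode xs) ys \<in> X"
      and f: "stmt 0 (code f) ys y \<in> X" by (auto simp: prod_encode_eq)
    obtain ys' where "ys = list_encode ys'" "list_all2 (\<lambda>g y. rec_eval g xs y) gs ys'"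
      using self_justified_args_sound[OF X g] Comp.IH(2) by blast
    then show ?thesis using f Comp.IH(1) by (auto intro: eval_Comp)
  qed (auto simp: prod_encode_eq)
next
  case (Prim f g)
  \<comment> \<open>The rule \<open>PrimS\<close> refers back to the same program with a smaller
    first argument, hence an inner induction on that argument.\<close>
  have *: "rec_eval (recf.Prim f g) (n # xs') y"
    if "stmt 0 (code (recf.Prim f g)) (list_encode (n # xs')) y \<in> X" for n xs' y
    using that
  proof (induction n arbitrary: y)
    case 0
    from 0 have "justified X 0 (code (recf.Prim f g)) (list_encode (0 # xs')) y" by (rule self_justifiedD[OF X])
    then show ?case
      by cases (use eval_Prim0 Prim.IH(1) in
        \<open>auto simp: prod_encode_eq list_encode_Cons_lcons simp del: list_encode.simps\<close>)
  next
    case (Suc n)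
    from Suc.prems have "justified X 0 (code (recf.Prim f g)) (list_encode (Suc n # xs')) y" by (rule self_justifiedD[OF X])
    then show ?case
    proof cases
      case (PrimS f' g' n' r z)
      then have "stmt 0 (code (recf.Prim f g)) (list_encode (n # xs')) z \<in> X"
        "stmt 0 (code g) (list_encode (z # n # xs')) y \<in> X"
        by (auto simp: prod_encode_eq list_encode_Cons_lcons simp del: list_encode.simps)
      then show ?thesis using Suc.IH Prim.IH(2) eval_PrimS by blast
    qed (auto simp: prod_encode_eq list_encode_Cons_lcons simp del: list_encode.simps)
  qed
  from Prim.prems have "justified X 0 (code (recf.Prim f g)) (list_encode xs) y" by (rule self_justifiedD[OF X])
  then obtain n r where "list_encode xs = lcons n r" by cases (auto simp: prod_encode_eq)
  then obtain xs' where "xs = n # xs'" by (auto elim: list_encode_eq_lconsE)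
  then show ?case using * Prim.prems by blast
next
  case (Mn f)
  from Mn.prems have "justified X 0 (code (recf.Mn f)) (list_encode xs) y" by (rule self_justifiedD[OF X])
  then show ?case
  proof cases
    case (Mn f')
    then have "stmt 0 (code f) (list_encode (y # xs)) 0 \<in> X"
      "\<forall>m<y. \<exists>z>0. stmt 0 (code f) (list_encode (m # xs)) z \<in> X"
      by (auto simp: prod_encode_eq list_encode_Cons_lcons simp del: list_encode.simps)
    then show ?thesis using Mn.IH by (meson eval_Mn)
  qed (auto simp: prod_encode_eq)
qed

section \<open>Completeness: every evaluation has a finite derivation\<close>

definition derivable :: "nat \<Rightarrow> bool" where
  "derivable z \<longleftrightarrow> (\<exists>X. finite X \<and> self_justified X \<and> z \<in> X)"

lemma derivable_0: "justified {} k a b c \<Longrightarrow> derivable (stmt k a b c)"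
  unfolding derivable_def
  by (rule exI[of _ "{stmt k a b c}"], use self_justified_insert[of "{}"] in \<open>auto simp: self_justified_def\<close>)

lemma derivable_2:
  assumes "derivable z" "derivable z'" "justified {z, z'} k a b c" shows "derivable (stmt k a b c)"
proof -
  obtain X X' where X: "finite X" "self_justified X" "z \<in> X" "finite X'" "self_justified X'" "z' \<in> X'"
    using assms unfolding derivable_def by blast
  have "justified (X \<union> X') k a b c" by (rule justified_mono[OF assms(3)]) (use X in auto)
  then show ?thesis unfolding derivable_def
    using X self_justified_insert[OF self_justified_Un[OF X(2,5)]]
    by (intro exI[of _ "insert (stmt k a b c) (X \<union> X')"]) simp
qed

lemma derivable_1:
  "derivable z \<Longrightarrow> justified {z} k a b c \<Longrightarrow> derivable (stmt k a b c)"
  by (rule derivable_2[of z z]) simp_all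

lemma derivable_Proj: "i < length xs \<Longrightarrow> derivable (stmt 0 (prod_encode (2, i)) (list_encode xs) (xs ! i))"
proof (induction i arbitrary: xs)
  case 0
  then show ?case
    by (cases xs) (auto simp: list_encode_Cons_lcons simp del: list_encode.simps intro: derivable_0 justified.intros)
next
  case (Suc i)
  then obtain x xs' where xs: "xs = x # xs'" by (cases xs) auto
  show ?case
    by (rule derivable_1[OF Suc.IH[of xs']])
      (use Suc.prems in \<open>auto simp: xs list_encode_Cons_lcons simp del: list_encode.simps intro: justified.intros\<close>)
qed

lemma derivable_args:
  "list_all2 (\<lambda>g y. derivable (stmt 0 (code g) b y)) gs ys \<Longrightarrow>
    derivable (stmt (Suc 0) (list_encode (map code gs)) b (list_encode ys))"
proof (induction rule: list_all2_induct)
  case Nil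
  then show ?case using derivable_0[OF justified.Nil] by simp
next
  case (Cons g gs y ys)
  show ?case unfolding list.map list_encode_Cons_lcons
    by (rule derivable_2[OF Cons(1,3)]) (auto intro: justified.Cons)
qed

text \<open>Each evaluation rule adds one statement to the union of the sets for its premises. The
  union stays finite, so that a number can code it by \<open>set_encode\<close>.\<close>

lemma derivable_complete:
  "rec_eval f xs y \<Longrightarrow> derivable (stmt 0 (code f) (list_encode xs) y)"
proof (induction rule: rec_eval.induct)
  case (eval_Zero xs)
  then show ?case by (auto intro: derivable_0 justified.intros)
next
  case (eval_Succ x xs)
  then show ?case
    by (auto simp: list_encode_Cons_lcons simp del: list_encode.simps intro: derivable_0 justified.Succ[simplified])
next
  case (eval_Proj i xs)
  then show ?case by (simp add: derivable_Proj)
next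
  case (eval_Comp xs gs ys f z)
  have "derivable (stmt (Suc 0) (list_encode (map code gs)) (list_encode xs) (list_encode ys))"
    by (rule derivable_args, rule list_all2_mono[OF eval_Comp.IH(1)]) auto
  from this eval_Comp.IH(2) show ?case
    unfolding code.simps by (rule derivable_2) (rule justified.Comp; simp)
next
  case (eval_Prim0 f xs z g)
  show ?case
    by (rule derivable_1[OF eval_Prim0.IH])
      (auto simp: list_encode_Cons_lcons simp del: list_encode.simps intro: justified.intros)
next
  case (eval_PrimS f g n xs y z)
  show ?case
    by (rule derivable_2[OF eval_PrimS.IH])
      (auto simp: list_encode_Cons_lcons simp del: list_encode.simps intro: justified.intros)
next
  case (eval_Mn f n xs)
  let ?g = "\<lambda>m y. stmt 0 (code f) (list_encode (m # xs)) y"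
  from eval_Mn obtain X where X: "finite X" "self_justified X" "?g n 0 \<in> X"
    unfolding derivable_def by blast
  from eval_Mn have "\<forall>m<n. \<exists>X. \<exists>y>0. finite X \<and> self_justified X \<and> ?g m y \<in> X"
    unfolding derivable_def by blast
  then obtain Z where Z: "\<And>m. m < n \<Longrightarrow> \<exists>y>0. finite (Z m) \<and> self_justified (Z m) \<and> ?g m y \<in> Z m"
    by metis
  \<comment> \<open>Minimisation has \<open>n\<close> further premises; one witness set is chosen
    for each of them and all are merged.\<close>
  define Y where "Y = X \<union> (\<Union>m\<in>{..<n}. Z m)"
  have "finite Y" "self_justified Y" unfolding Y_def
    using X Z by (auto intro!: self_justified_Un self_justified_UN)
  moreover have "justified Y 0 (code (Mn f)) (list_encode xs) n"
    unfolding code.simps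
  proof (rule justified.Mn)
    show "stmt 0 (code f) (lcons n (list_encode xs)) 0 \<in> Y"
      using X(3) by (simp add: Y_def list_encode_Cons_lcons del: list_encode.simps)
    show "\<forall>m<n. \<exists>y>0. stmt 0 (code f) (lcons m (list_encode xs)) y \<in> Y"
      using Z by (fastforce simp: Y_def list_encode_Cons_lcons simp del: list_encode.simps)
  qed
  ultimately show ?case unfolding derivable_def using self_justified_insert
    by (intro exI[of _ "insert (stmt 0 (code (Mn f)) (list_encode xs) n) Y"]) blast
qed

lemma list_all2_rec_eval_unique:
  "list_all2 (\<lambda>g y. \<forall>z. rec_eval g xs z \<longrightarrow> y = z) gs ys \<Longrightarrow> list_all2 (\<lambda>g y. rec_eval g xs y) gs zs \<Longrightarrow> ys = zs"
proof (induction arbitrary: zs rule: list_all2_induct)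
  case (Cons g gs y ys)
  then show ?case by (cases zs) auto
qed auto

text \<open>Soundness only says that a derived value is a value; uniqueness identifies it with that
  of the given total function.\<close>

lemma rec_eval_unique: "rec_eval f xs y \<Longrightarrow> rec_eval f xs z \<Longrightarrow> y = z"
proof (induction arbitrary: z rule: rec_eval.induct)
  case (eval_Comp xs gs ys f z z')
  from eval_Comp.prems obtain zs where zs: "list_all2 (\<lambda>g y. rec_eval g xs y) gs zs" "rec_eval f zs z'"
    by cases auto
  have "ys = zs"
    by (rule list_all2_rec_eval_unique[OF _ zs(1)], rule list_all2_mono[OF eval_Comp.IH(1)]) auto
  then show ?case using zs eval_Comp.IH by blast
next
  case (eval_Mn f n xs)
  from eval_Mn.prems have z: "rec_eval f (z # xs) 0" "\<forall>m<z. \<exists>y>0. rec_eval f (m # xs) y"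
    by (cases; auto)+
  show ?case
  proof (rule linorder_cases[of n z])
    assume "n < z"
    then show ?thesis using z(2) eval_Mn.IH by fastforce
  next
    assume "z < n"
    then show ?thesis using z(1) eval_Mn.IH by fastforce
  qed
next
  case (eval_PrimS f g n xs y z z')
  from eval_PrimS.prems show ?case by cases (use eval_PrimS.IH in blast)
next
  case (eval_Prim0 f xs z g z')
  from eval_Prim0.prems show ?case by cases (use eval_Prim0.IH in blast)
next
  case (eval_Zero xs)
  then show ?case by cases simp
next
  case (eval_Succ x xs)
  then show ?case by cases simp
next
  case (eval_Proj i xs)
  from eval_Proj.prems show ?case by cases simp
qed

section \<open>Decidability of self-justification for coded finite sets\<close>

definition justified_below :: "nat \<Rightarrow> nat \<Rightarrow> nat \<Rightarrow> nat \<Rightarrow> nat \<Rightarrow> bool" where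
  "justified_below d k a b c \<longleftrightarrow>
    k = 0 \<and> a = prod_encode (0, 0) \<and> c = 0 \<or>
    k = 0 \<and> a = prod_encode (1, 0) \<and> (\<exists>x<d. \<exists>r<d. b = lcons x r \<and> c = Suc x) \<or>
    k = 0 \<and> a = prod_encode (2, 0) \<and> (\<exists>r<d. b = lcons c r) \<or>
    k = 0 \<and> (\<exists>i<d. \<exists>x<d. \<exists>r<d. a = prod_encode (2, Suc i) \<and> b = lcons x r \<and>
      stmt 0 (prod_encode (2, i)) r c \<in> set_decode d) \<or>
    k = 0 \<and> (\<exists>f<d. \<exists>gs<d. \<exists>ys<d. a = prod_encode (3, prod_encode (f, gs)) \<and>
      stmt 1 gs b ys \<in> set_decode d \<and> stmt 0 f ys c \<in> set_decode d) \<or>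
    k = 0 \<and> (\<exists>f<d. \<exists>g<d. \<exists>r<d. a = prod_encode (4, prod_encode (f, g)) \<and> b = lcons 0 r \<and>
      stmt 0 f r c \<in> set_decode d) \<or>
    k = 0 \<and> (\<exists>f<d. \<exists>g<d. \<exists>r<d. \<exists>n<d. \<exists>y<d.
      a = prod_encode (4, prod_encode (f, g)) \<and> b = lcons (Suc n) r \<and>
      stmt 0 a (lcons n r) y \<in> set_decode d \<and> stmt 0 g (lcons y (lcons n r)) c \<in> set_decode d) \<or>
    k = 0 \<and> (\<exists>f<d. a = prod_encode (5, f) \<and> stmt 0 f (lcons c b) 0 \<in> set_decode d \<and>
      (\<forall>m<c. \<exists>y<d. 0 < y \<and> stmt 0 f (lcons m b) y \<in> set_decode d)) \<or>
    k = 1 \<and> a = 0 \<and> c = 0 \<or>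
    k = 1 \<and> (\<exists>g<d. \<exists>gs<d. \<exists>y<d. \<exists>ys<d. a = lcons g gs \<and> c = lcons y ys \<and>
      stmt 0 g b y \<in> set_decode d \<and> stmt 1 gs b ys \<in> set_decode d)"

lemma set_decode_less: "x \<in> set_decode d \<Longrightarrow> x < d"
proof -
  assume "x \<in> set_decode d"
  then have "2 ^ x \<le> d" by (metis (no_types) div_less even_zero mem_Collect_eq not_le set_decode_def)
  then show "x < d" using less_exp[of x] by linarith
qed

lemma prod_encode_lessD: "prod_encode (a, b) < d \<Longrightarrow> a < d \<and> b < d"
  using le_prod_encode_1[of a b] le_prod_encode_2[of b a] by linarith

lemma lcons_lessD: "lcons a b < d \<Longrightarrow> a < d \<and> b < d"
  unfolding lcons_def using prod_encode_lessD by (meson Suc_lessD)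

lemma stmt_lessD: "stmt k a b c \<in> set_decode d \<Longrightarrow> k < d \<and> a < d \<and> b < d \<and> c < d"
  unfolding stmt_def using set_decode_less prod_encode_lessD by meson

lemma justified_below_imp: "justified_below d k a b c \<Longrightarrow> justified (set_decode d) k a b c"
  unfolding justified_below_def One_nat_def
  by (elim disjE conjE exE; hypsubst; rule justified.intros; blast)

text \<open>Membership of the statement itself bounds \<open>a\<close>, \<open>b\<close> and
  \<open>c\<close>, and with them all witnesses decoded from these; the remaining witnesses occur in
  premises, which lie in the set too.\<close>

lemma justified_imp_below:
  assumes "justified (set_decode d) k a b c" "stmt k a b c \<in> set_decode d"
  shows "justified_below d k a b c"
proof -
  from assms(2) have "a < d" "b < d" "c < d" using stmt_lessD by auto
  with assms(1) show ?thesis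
    by cases (auto simp: justified_below_def prod_encode_eq dest!: prod_encode_lessD lcons_lessD dest: stmt_lessD,
        metis Suc_lessD stmt_lessD)
qed

lemma self_justified_iff:
  "self_justified (set_decode d) \<longleftrightarrow>
    (\<forall>k<d. \<forall>a<d. \<forall>b<d. \<forall>c<d. stmt k a b c \<in> set_decode d \<longrightarrow> justified_below d k a b c)"
  unfolding self_justified_def using justified_below_imp justified_imp_below stmt_lessD by meson

lemma decidable_mem_set_decode [rec_intros]:
  "recursive A \<Longrightarrow> recursive B \<Longrightarrow> decidable (\<lambda>e. A e \<in> set_decode (B e))"
  unfolding set_decode_def by (simp, intro rec_intros)

lemma recursive_stmt [rec_intros]:
  "recursive K \<Longrightarrow> recursive A \<Longrightarrow> recursive B \<Longrightarrow> recursive D \<Longrightarrow>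
    recursive (\<lambda>e. stmt (K e) (A e) (B e) (D e))"
  unfolding stmt_def by (intro rec_intros)

lemma recursive_lcons [rec_intros]:
  "recursive A \<Longrightarrow> recursive B \<Longrightarrow> recursive (\<lambda>e. lcons (A e) (B e))"
  unfolding lcons_def by (intro rec_intros)

lemma decidable_self_justified: "decidable (\<lambda>e. self_justified (set_decode (e 0)))"
  unfolding self_justified_iff justified_below_def by (intro rec_intros)

text \<open>The time bounds both the value and the code of the derivation. This makes the predicate
  decidable and monotone in \<open>t\<close>, and lets convergence imply that the value is at most
  \<open>t\<close>.\<close>

definition converged :: "nat \<Rightarrow> nat \<Rightarrow> nat \<Rightarrow> bool" where
  "converged i j t \<longleftrightarrow> (\<exists>y<Suc t. \<exists>d<Suc t. self_justified (set_decode d) \<and>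
    stmt 0 i (list_encode [j]) y \<in> set_decode d)"

text \<open>Counting the converged initial segments gives the length of the longest one, cut off at
  \<open>t\<close>.\<close>

definition conv_length :: "nat \<Rightarrow> nat \<Rightarrow> nat" where
  "conv_length i t = (\<Sum>m<t. if \<forall>j<Suc m. converged i j t then 1 else 0)"

lemma recursive_conv_length [rec_intros]:
  assumes "recursive A" "recursive B"
  shows "recursive (\<lambda>e. conv_length (A e) (B e))"
proof (rule recursive_comp2[OF _ assms])
  have sj: "recursive D \<Longrightarrow> decidable (\<lambda>e. self_justified (set_decode (D e)))" for D
    using recursive_comp1[where f = "\<lambda>d. if self_justified (set_decode d) then 1 else 0"]
      decidable_self_justified unfolding decidable_def by blast
  show "recursive (\<lambda>e. conv_length (e 0) (e 1))"
    unfolding conv_length_def converged_def list_encode.simps by (intro rec_intros sj)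
qed

lemma converged_mono: "converged i j t \<Longrightarrow> t \<le> t' \<Longrightarrow> converged i j t'"
  unfolding converged_def by (meson Suc_le_mono less_le_trans)

lemma conv_length_mono: "t \<le> t' \<Longrightarrow> conv_length i t \<le> conv_length i t'"
proof -
  assume "t \<le> t'"
  then have "conv_length i t \<le> (\<Sum>m<t. if \<forall>j<Suc m. converged i j t' then 1 else 0)"
    unfolding conv_length_def by (intro sum_mono) (auto dest: converged_mono)
  also have "\<dots> \<le> conv_length i t'"
    unfolding conv_length_def using \<open>t \<le> t'\<close> by (intro sum_mono2) auto
  finally show ?thesis .
qed

lemma converged_if_less_conv_length:
  assumes "j < conv_length i t" shows "converged i j t"
proof (rule ccontr)
  assume "\<not> converged i j t"
  then have "conv_length i t = (\<Sum>m\<in>{..<t} \<inter> {..<j}. if \<forall>j<Suc m. converged i j t then 1 else 0)"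
    unfolding conv_length_def
    by (intro sum.mono_neutral_right) (auto simp: not_less Suc_le_eq not_le[symmetric])
  also have "\<dots> \<le> (\<Sum>m\<in>{..<j}. 1)"
    by (rule order_trans[OF sum_mono[where g = "\<lambda>_. 1"] sum_mono2]) auto
  finally show False using assms by simp
qed

text \<open>Soundness with uniqueness gives the first property, completeness the second. These two
  facts are all that the construction learns about a computable function.\<close>

lemma conv_length_universal:
  assumes "computable g"
  obtains i where "\<And>t j. j < conv_length i t \<Longrightarrow> g j \<le> t" and "\<And>m. \<exists>t. m \<le> conv_length i t"
proof -
  obtain f where f: "\<And>n. rec_eval f [n] (g n)" using assms unfolding computable_def by blast
  show ?thesis
  proof (rule that[of "code f"])
    fix t j assume "j < conv_length (code f) t"
    then obtain y d where "y \<le> t" "self_justified (set_decode d)"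
      "stmt 0 (code f) (list_encode [j]) y \<in> set_decode d"
      using converged_if_less_conv_length unfolding converged_def by (meson less_Suc_eq_le)
    then show "g j \<le> t" using self_justified_sound rec_eval_unique f by metis
  next
    fix m
    have "\<exists>t. converged (code f) j t" for j
    proof -
      obtain X where X: "finite X" "self_justified X" "stmt 0 (code f) (list_encode [j]) (g j) \<in> X"
        using derivable_complete[OF f[of j]] unfolding derivable_def by blast
      then show ?thesis unfolding converged_def
        by (intro exI[of _ "g j + set_encode X"] exI[of _ "g j"] exI[of _ "set_encode X"] conjI)
          (auto simp: set_encode_inverse)
    qed
    then obtain T where T: "\<And>j. converged (code f) j (T j)" by metis
    \<comment> \<open>The summand \<open>m\<close> lifts the cut-off in \<open>conv_length\<close>;
      the sum dominates every \<open>T j\<close>.\<close>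
    define t where "t = m + (\<Sum>j<m. T j)"
    have conv: "converged (code f) j t" if "j < m" for j
    proof (rule converged_mono[OF T])
      show "T j \<le> t" unfolding t_def using that member_le_sum[of j "{..<m}" T] by simp
    qed
    have "m = (\<Sum>l<m. if \<forall>j<Suc l. converged (code f) j t then 1 else 0)"
      using conv by simp
    also have "\<dots> \<le> conv_length (code f) t"
      unfolding conv_length_def by (intro sum_mono2) (auto simp: t_def)
    finally show "\<exists>t. m \<le> conv_length (code f) t" by blast
  qed
qed

section \<open>The tree of guesses\<close>

text \<open>
  Nodes are positive numbers: the root is 1, and \<open>v\<close> has the children \<open>2 * v\<close>, guessing that
  \<open>L (depth v)\<close> is unbounded, and \<open>2 * v + 1\<close>. The number 0, the parent of the root, stands for the real
  under construction.
\<close>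

definition pre :: "nat \<Rightarrow> nat \<Rightarrow> bool" where
  "pre v w \<longleftrightarrow> (\<exists>j. w div 2 ^ j = v)"

text \<open>\<open>pre\<close> is the prefix order of binary expansions, and the paths split at the
  siblings \<open>b\<close> and \<open>Suc b\<close>. Positivity of \<open>b\<close> excludes the
  pair 0 and 1, through which every positive node would lie to the right of every node.\<close>

definition right_of :: "nat \<Rightarrow> nat \<Rightarrow> bool" where
  "right_of w y \<longleftrightarrow> (\<exists>b. 0 < b \<and> even b \<and> pre b y \<and> pre (Suc b) w)"

fun depth :: "nat \<Rightarrow> nat" where
  "depth v = (if v \<le> 1 then 0 else Suc (depth (v div 2)))"

declare depth.simps [simp del]

lemma pre_refl [simp]: "pre v v"
  unfolding pre_def by (rule exI[of _ 0]) simp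

lemma pre_0 [simp]: "pre 0 w"
  unfolding pre_def by (rule exI[of _ w]) (simp add: less_exp)

lemma pre_div2 [simp]: "pre (w div 2) w"
  unfolding pre_def by (rule exI[of _ 1]) simp

lemma pre_trans: "pre u v \<Longrightarrow> pre v w \<Longrightarrow> pre u w"
  unfolding pre_def by (metis div_mult2_eq power_add)

lemma pre_le: "pre v w \<Longrightarrow> v \<le> w"
  unfolding pre_def by auto

lemma pre_cases: "pre v w \<longleftrightarrow> v = w \<or> pre v (w div 2)"
proof
  assume "pre v w"
  then obtain j where "w div 2 ^ j = v" unfolding pre_def by blast
  then show "v = w \<or> pre v (w div 2)"
    by (cases j) (auto simp: pre_def div_mult2_eq)
qed (auto intro: pre_trans)

lemma finite_pre [simp]: "finite {v. pre v w}"
  by (rule finite_subset[of _ "{..w}"]) (auto dest: pre_le)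

lemma pre_one: "0 < w \<Longrightarrow> pre 1 w"
proof (induction w rule: less_induct)
  case (less w)
  show ?case
  proof (cases "w = 1")
    case False
    then show ?thesis using less.IH[of "w div 2"] less.prems pre_cases[of 1 w] by simp
  qed simp
qed

lemma pre_linear: "pre a v \<Longrightarrow> pre b v \<Longrightarrow> pre a b \<or> pre b a"
proof (induction v rule: less_induct)
  case (less v)
  show ?case
  proof (cases "v = 0 \<or> a = v \<or> b = v")
    case True
    then show ?thesis using less.prems pre_le[of a v] pre_le[of b v] by auto
  next
    case False
    then show ?thesis
      using less.IH[of "v div 2"] less.prems pre_cases[of a v] pre_cases[of b v] by simp
  qed
qed

lemma pre_child: "pre u y \<Longrightarrow> y \<noteq> u \<Longrightarrow> pre (2 * u) y \<or> pre (2 * u + 1) y"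
proof (induction y rule: less_induct)
  case (less y)
  show ?case
  proof (cases "y div 2 = u")
    case True
    then have "y = 2 * u \<or> y = 2 * u + 1" by presburger
    then show ?thesis by auto
  next
    case False
    have "pre u (y div 2)" using less.prems pre_cases[of u y] by blast
    moreover have "y \<noteq> 0" using less.prems pre_le by fastforce
    ultimately have "pre (2 * u) (y div 2) \<or> pre (2 * u + 1) (y div 2)"
      using less.IH[of "y div 2"] False by simp
    then show ?thesis using pre_trans[OF _ pre_div2] by blast
  qed
qed

lemma not_pre_siblings:
  assumes "0 < b" "even b" "pre b v" "pre (Suc b) v"
  shows False
proof -
  from pre_linear[OF assms(3,4)] show False
  proof
    assume "pre b (Suc b)"
    then have "b = Suc b \<or> pre b (Suc b div 2)" by (subst (asm) pre_cases) auto
    then show False using pre_le[of b "Suc b div 2"] assms(1,2) by auto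
  next
    assume "pre (Suc b) b"
    then show False using pre_le by fastforce
  qed
qed

lemma right_of_not_pre:
  assumes "right_of v w" shows "\<not> pre v w" "\<not> pre w v"
  using assms not_pre_siblings pre_trans unfolding right_of_def by blast+

lemma right_of_mono: "right_of v c \<Longrightarrow> pre v w \<Longrightarrow> right_of w c"
  unfolding right_of_def using pre_trans by blast

lemma right_of_mono2: "right_of v c \<Longrightarrow> pre c w \<Longrightarrow> right_of v w"
  unfolding right_of_def using pre_trans by blast

lemma not_right_of_self [simp]: "\<not> right_of c c"
  using right_of_not_pre(1)[of c c] by auto

lemma not_right_of_half [simp]: "\<not> right_of (c div 2) c"
  using right_of_not_pre(1)[of "c div 2" c] by auto

lemma not_right_of_small: "w \<le> 1 \<Longrightarrow> \<not> right_of w c"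
  unfolding right_of_def by (auto dest: pre_le)

lemma right_of_double: "right_of (2 * v) c \<Longrightarrow> right_of v c"
proof -
  assume "right_of (2 * v) c"
  then obtain b where b: "0 < b" "even b" "pre b c" "pre (Suc b) (2 * v)" unfolding right_of_def by blast
  then have "Suc b \<noteq> 2 * v" by presburger
  then have "pre (Suc b) v" using b(4) pre_cases[of "Suc b" "2 * v"] by auto
  then show ?thesis unfolding right_of_def using b by blast
qed

lemma right_of_double_Suc: "right_of (2 * v + 1) c \<Longrightarrow> right_of v c \<or> pre (2 * v) c"
proof -
  assume "right_of (2 * v + 1) c"
  then obtain b where b: "0 < b" "even b" "pre b c" "pre (Suc b) (2 * v + 1)" unfolding right_of_def by blast
  then have "b = 2 * v \<or> pre (Suc b) v" using pre_cases[of "Suc b" "2 * v + 1"] by auto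
  then show ?thesis unfolding right_of_def using b by blast
qed

text \<open>The sibling \<open>Suc b\<close> is either \<open>c\<close>, whose parent is then a
  proper ancestor of \<open>w\<close>, or lies above \<open>c div 2\<close>. So the proper ancestors
  of \<open>w\<close> and the nodes to its right form a region closed under parents.\<close>

lemma right_of_parent: "right_of c w \<Longrightarrow> right_of (c div 2) w \<or> pre (c div 2) w \<and> c div 2 \<noteq> w"
proof -
  assume "right_of c w"
  then obtain b where b: "0 < b" "even b" "pre b w" "pre (Suc b) c" unfolding right_of_def by blast
  then consider "c = Suc b" | "pre (Suc b) (c div 2)" using pre_cases[of "Suc b" c] by blast
  then show ?thesis
  proof cases
    case 1
    then have "c div 2 = b div 2" using b by auto
    moreover have "b div 2 < w" using b pre_le[of b w] by auto
    ultimately show ?thesis using b pre_trans[OF pre_div2 b(3)] by auto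
  next
    case 2
    then show ?thesis unfolding right_of_def using b by blast
  qed
qed

text \<open>By induction along the path to \<open>w\<close>; only if the parent of \<open>w\<close>
  is a prefix of \<open>y\<close> does the next digit of \<open>y\<close> matter.\<close>

lemma tree_cases:
  "0 < y \<Longrightarrow> 0 < w \<Longrightarrow> pre y w \<or> pre w y \<or> right_of w y \<or> right_of y w"
proof (induction w rule: less_induct)
  case (less w)
  show ?case
  proof (cases "w = 1")
    case True
    then show ?thesis using pre_one less.prems by simp
  next
    case False
    define u where "u = w div 2"
    have u: "0 < u" "u < w" using False less.prems by (auto simp: u_def)
    have w: "w = 2 * u \<or> w = 2 * u + 1" unfolding u_def by presburger
    have pu: "pre u w" unfolding u_def by simp
    consider "pre y u" | "pre u y" | "right_of u y" | "right_of y u"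
      using less.IH[OF u(2)] less.prems u by blast
    then show ?thesis
    proof cases
      case 2
      consider "y = u" | "pre (2 * u) y" | "pre (2 * u + 1) y" using pre_child[OF 2] by blast
      then show ?thesis
      proof cases
        case 1
        then show ?thesis using pu by blast
      next
        case 2
        then show ?thesis using w u(1) by (auto simp: right_of_def intro!: exI[of _ "2 * u"])
      next
        case 3
        then show ?thesis using w u(1) by (auto simp: right_of_def intro!: exI[of _ "2 * u"])
      qed
    qed (use pu pre_trans right_of_mono right_of_mono2 in blast)+
  qed
qed

lemma le_double_div_mult: "1 \<le> n div k \<Longrightarrow> n \<le> 2 * (k * (n div k))" for n k :: nat
proof -
  assume *: "1 \<le> n div k"
  then have "n mod k < k" by (cases k) auto
  then show ?thesis using mult_le_mono2[OF *, of k] mult_div_mod_eq[of k n] by linarith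
qed

section \<open>The construction\<close>

text \<open>
  In a state at time \<open>t\<close>, \<open>c\<close> is the node to be visited, \<open>r v / 2 ^ t\<close> is the active mass at \<open>v\<close>, \<open>k v\<close> counts
  the effective visits since the last cancellation, and \<open>l v\<close> is the successor of the time of the last
  visit, or 0 if there was none since then.
\<close>

definition pending :: "nat \<Rightarrow> (nat \<Rightarrow> nat) \<Rightarrow> nat \<Rightarrow> nat" where
  "pending t l u = (if l u = 0 then 0 else 2 ^ (t - l u))"

text \<open>A division-free form, in units of \<open>1 / 2 ^ t\<close>, of the bound
  \<open>1 / Suc (k c)\<close> on the mass of the proper ancestors, mass not yet activated
  included.\<close>

definition effective :: "nat \<Rightarrow> nat \<Rightarrow> (nat \<Rightarrow> nat) \<Rightarrow> (nat \<Rightarrow> nat) \<Rightarrow> (nat \<Rightarrow> nat) \<Rightarrow> bool" where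
  "effective t c r k l \<longleftrightarrow>
    Suc (k c) * (\<Sum>u<c. if 0 < u \<and> pre u c then r u + pending t l u else 0) \<le> 2 ^ t"

definition released :: "nat \<Rightarrow> nat \<Rightarrow> (nat \<Rightarrow> nat) \<Rightarrow> (nat \<Rightarrow> nat) \<Rightarrow> (nat \<Rightarrow> nat) \<Rightarrow> nat" where
  "released t c r k l = (if effective t c r k l then min (r c) (2 ^ t div Suc (k c)) else 0)"

text \<open>The factor 2 converts to the units of the next time. The mass activated here was created
  at the preceding visit; the mass created now is recorded only by \<open>next_lst\<close>.\<close>

definition next_res :: "nat \<Rightarrow> nat \<Rightarrow> (nat \<Rightarrow> nat) \<Rightarrow> (nat \<Rightarrow> nat) \<Rightarrow> (nat \<Rightarrow> nat) \<Rightarrow> nat \<Rightarrow> nat" where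
  "next_res t c r k l u =
    (if right_of u c then 0
     else if u = c then 2 * (r u - released t c r k l + pending t l u)
     else if u = c div 2 then 2 * (r u + released t c r k l)
     else 2 * r u)"

definition next_cnt :: "nat \<Rightarrow> nat \<Rightarrow> (nat \<Rightarrow> nat) \<Rightarrow> (nat \<Rightarrow> nat) \<Rightarrow> (nat \<Rightarrow> nat) \<Rightarrow> nat \<Rightarrow> nat" where
  "next_cnt t c r k l u =
    (if right_of u c then 0 else if u = c \<and> effective t c r k l then Suc (k u) else k u)"

definition next_lst :: "nat \<Rightarrow> nat \<Rightarrow> (nat \<Rightarrow> nat) \<Rightarrow> nat \<Rightarrow> nat" where
  "next_lst t c l u = (if right_of u c then 0 else if u = c then Suc t else l u)"

text \<open>The left child is taken once convergence has passed the time of its last visit, so each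
  of its visits certifies convergence beyond the preceding one.\<close>

definition next_child :: "(nat \<Rightarrow> nat \<Rightarrow> nat) \<Rightarrow> nat \<Rightarrow> nat \<Rightarrow> (nat \<Rightarrow> nat) \<Rightarrow> nat" where
  "next_child L t c l = (if l (2 * c) < L (depth c) t then 2 * c else 2 * c + 1)"

text \<open>The depth of a descent is bounded by the time of the previous one, so that the root is visited again.\<close>

definition next_cur :: "(nat \<Rightarrow> nat \<Rightarrow> nat) \<Rightarrow> nat \<Rightarrow> nat \<Rightarrow> (nat \<Rightarrow> nat) \<Rightarrow> nat" where
  "next_cur L t c l = (if next_child L t c l \<le> l 1 then next_child L t c l else 1)"

locale tree_construction =
  fixes L :: "nat \<Rightarrow> nat \<Rightarrow> nat"
  assumes L_mono: "t \<le> t' \<Longrightarrow> L e t \<le> L e t'"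
begin

primrec state :: "nat \<Rightarrow> nat \<times> (nat \<Rightarrow> nat) \<times> (nat \<Rightarrow> nat) \<times> (nat \<Rightarrow> nat)" where
  "state 0 = (1, \<lambda>_. 0, \<lambda>_. 0, \<lambda>_. 0)"
| "state (Suc t) = (case state t of (c, r, k, l) \<Rightarrow>
    (next_cur L t c l, next_res t c r k l, next_cnt t c r k l, next_lst t c l))"

definition cur :: "nat \<Rightarrow> nat" where "cur t = fst (state t)"
definition res :: "nat \<Rightarrow> nat \<Rightarrow> nat" where "res t = fst (snd (state t))"
definition cnt :: "nat \<Rightarrow> nat \<Rightarrow> nat" where "cnt t = fst (snd (snd (state t)))"
definition lst :: "nat \<Rightarrow> nat \<Rightarrow> nat" where "lst t = snd (snd (snd (state t)))"

lemma state_0 [simp]: "cur 0 = 1" "res 0 v = 0" "cnt 0 v = 0" "lst 0 v = 0"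
  by (simp_all add: cur_def res_def cnt_def lst_def)

lemma state_Suc:
  "cur (Suc t) = next_cur L t (cur t) (lst t)"
  "res (Suc t) = next_res t (cur t) (res t) (cnt t) (lst t)"
  "cnt (Suc t) = next_cnt t (cur t) (res t) (cnt t) (lst t)"
  "lst (Suc t) = next_lst t (cur t) (lst t)"
  by (simp_all add: cur_def res_def cnt_def lst_def split: prod.split)

abbreviation eff :: "nat \<Rightarrow> bool" where
  "eff t \<equiv> effective t (cur t) (res t) (cnt t) (lst t)"

section \<open>Masses as real numbers, and their conservation\<close>

definition R :: "nat \<Rightarrow> nat \<Rightarrow> real" where "R t v = real (res t v) / 2 ^ t"
definition Q :: "nat \<Rightarrow> nat \<Rightarrow> real" where "Q t v = (if lst t v = 0 then 0 else 1 / 2 ^ lst t v)"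
definition rel :: "nat \<Rightarrow> real" where
  "rel t = real (released t (cur t) (res t) (cnt t) (lst t)) / 2 ^ t"

lemma cur_Suc_cases:
  obtains "cur (Suc t) = 1" | "cur (Suc t) = 2 * cur t" | "cur (Suc t) = 2 * cur t + 1"
  unfolding state_Suc next_cur_def next_child_def by presburger

lemma cur_pos [simp]: "0 < cur t"
proof (induction t)
  case (Suc t)
  then show ?case using cur_Suc_cases[of t] by force
qed simp

lemma cur_Suc_half: "cur (Suc t) \<noteq> 1 \<Longrightarrow> cur (Suc t) div 2 = cur t"
  using cur_Suc_cases[of t] by force

lemma half_cur_less: "cur t div 2 < cur t" by simp

lemma lst_Suc: "lst (Suc t) v = (if right_of v (cur t) then 0 else if v = cur t then Suc t else lst t v)"
  by (simp add: state_Suc next_lst_def)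

lemma cnt_Suc: "cnt (Suc t) v =
    (if right_of v (cur t) then 0 else if v = cur t \<and> eff t then Suc (cnt t v) else cnt t v)"
  by (simp add: state_Suc next_cnt_def)

lemma lst_le: "lst t v \<le> t"
  by (induction t) (auto simp: lst_Suc intro: le_SucI)

lemma cnt_le: "cnt t v \<le> t"
  by (induction t) (auto simp: cnt_Suc intro: le_SucI)

lemma cur_le: "cur t \<le> Suc t"
proof (cases t)
  case (Suc t')
  then show ?thesis using lst_le[of t' 1] by (simp add: state_Suc next_cur_def)
qed simp

lemma lst_visited: "lst t v = Suc u \<Longrightarrow> u < t \<and> cur u = v"
  by (induction t) (auto simp: lst_Suc less_Suc_eq split: if_splits)

lemma R_nonneg [simp]: "0 \<le> R t v" and Q_nonneg [simp]: "0 \<le> Q t v" and rel_nonneg [simp]: "0 \<le> rel t"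
  by (simp_all add: R_def Q_def rel_def)

lemma rel_le: "rel t \<le> R t (cur t)"
  unfolding rel_def R_def released_def by (auto intro!: divide_right_mono)

lemma rel_not_eff: "\<not> eff t \<Longrightarrow> rel t = 0"
  unfolding rel_def released_def by simp

lemma pending_eq_Q: "real (pending t (lst t) v) / 2 ^ t = Q t v"
proof (cases "lst t v = 0")
  case False
  have "(2::real) ^ t = 2 ^ (t - lst t v) * 2 ^ lst t v"
    using lst_le[of t v] by (simp flip: power_add)
  then show ?thesis using False by (simp add: pending_def Q_def)
qed (simp add: pending_def Q_def)

lemma R_Suc: "R (Suc t) v =
    (if right_of v (cur t) then 0 else R t v + (if v = cur t then Q t v - rel t else 0)
      + (if v = cur t div 2 then rel t else 0))"
proof -
  have le: "released t (cur t) (res t) (cnt t) (lst t) \<le> res t (cur t)"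
    by (simp add: released_def)
  have ne: "cur t \<noteq> cur t div 2" using half_cur_less[of t] by linarith
  show ?thesis
    using le ne
    by (auto simp: R_def state_Suc next_res_def rel_def pending_eq_Q[symmetric] of_nat_diff field_simps)
qed

lemma Q_Suc: "Q (Suc t) v =
    (if right_of v (cur t) then 0 else if v = cur t then 1 / 2 ^ Suc t else Q t v)"
  by (simp add: Q_def lst_Suc)

lemma rel_le_inverse: "rel t \<le> 1 / real (Suc (cnt t (cur t)))"
proof -
  let ?k = "Suc (cnt t (cur t))"
  have "real (released t (cur t) (res t) (cnt t) (lst t)) \<le> real (2 ^ t div ?k)"
    unfolding released_def by (auto simp del: of_nat_Suc)
  also have "\<dots> \<le> 2 ^ t / real ?k" using of_nat_div_le_of_nat[of "2 ^ t" ?k, where 'a = real] by simp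
  finally show ?thesis unfolding rel_def by (simp add: field_simps)
qed

text \<open>Since \<open>cnt\<close> is at most \<open>t\<close>, dividing \<open>2 ^ t\<close> by
  the incremented count gives at least 1, and rounding down loses at most a factor 2.\<close>

lemma rel_ge: "eff t \<Longrightarrow> min (R t (cur t)) (1 / (2 * real (Suc (cnt t (cur t))))) \<le> rel t"
proof -
  let ?k = "Suc (cnt t (cur t))"
  assume "eff t"
  have "?k \<le> 2 ^ t" using cnt_le[of t "cur t"] less_exp[of t] by linarith
  then have "1 \<le> 2 ^ t div ?k" using div_le_mono[of ?k "2 ^ t" ?k] by (simp del: One_nat_def)
  then have "2 ^ t \<le> 2 * (?k * (2 ^ t div ?k))" by (rule le_double_div_mult)
  then have "real (2 ^ t) \<le> real (2 * (?k * (2 ^ t div ?k)))" by (simp only: of_nat_le_iff)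
  then have "2 ^ t \<le> 2 * (real ?k * real (2 ^ t div ?k))" by (simp only: of_nat_mult of_nat_power of_nat_numeral)
  then have "1 / (2 * real ?k) \<le> real (2 ^ t div ?k) / 2 ^ t" by (simp add: field_simps del: of_nat_Suc)
  then show ?thesis
    using \<open>eff t\<close> by (auto simp: rel_def released_def R_def min_def)
qed

definition anc :: "nat \<Rightarrow> nat set" where "anc w = {v. 0 < v \<and> pre v w \<and> v \<noteq> w}"

lemma finite_anc [simp]: "finite (anc w)"
  unfolding anc_def by (rule finite_subset[OF _ finite_pre[of w]]) auto

lemma eff_iff: "eff t \<longleftrightarrow> (\<Sum>u\<in>anc (cur t). R t u + Q t u) \<le> 1 / real (Suc (cnt t (cur t)))"
proof -
  let ?k = "Suc (cnt t (cur t))" and ?s = "\<lambda>u. res t u + pending t (lst t) u"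
  have "(\<Sum>u<cur t. if 0 < u \<and> pre u (cur t) then ?s u else 0) = (\<Sum>u\<in>anc (cur t). ?s u)"
  proof -
    have "anc (cur t) = {u \<in> {..<cur t}. 0 < u \<and> pre u (cur t)}"
      unfolding anc_def by (auto dest: pre_le intro: le_neq_implies_less)
    then show ?thesis by (simp only: sum.inter_filter finite_lessThan)
  qed
  then have "eff t \<longleftrightarrow> ?k * (\<Sum>u\<in>anc (cur t). ?s u) \<le> 2 ^ t" unfolding effective_def by simp
  also have "\<dots> \<longleftrightarrow> real ?k * real (\<Sum>u\<in>anc (cur t). ?s u) \<le> 2 ^ t"
    by (metis (no_types, lifting) of_nat_le_iff of_nat_mult of_nat_numeral of_nat_power)
  also have "real (\<Sum>u\<in>anc (cur t). ?s u) = 2 ^ t * (\<Sum>u\<in>anc (cur t). R t u + Q t u)"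
    by (simp add: sum_distrib_left R_def pending_eq_Q[symmetric] distrib_left)
  also have "real ?k * (2 ^ t * (\<Sum>u\<in>anc (cur t). R t u + Q t u)) \<le> 2 ^ t \<longleftrightarrow>
      (\<Sum>u\<in>anc (cur t). R t u + Q t u) \<le> 1 / real ?k"
    by (simp add: field_simps del: of_nat_Suc)
  finally show ?thesis .
qed

text \<open>Activation keeps mass in place, transport within \<open>S\<close> cancels, and cancelled
  nodes only lose mass. What remains is the mass newly created in \<open>S\<close> and an inflow
  from a visited node outside \<open>S\<close> to its parent.\<close>

lemma mass_step:
  assumes S: "finite S" "cur t \<in> S \<Longrightarrow> cur t div 2 \<in> S"
  shows "(\<Sum>v\<in>S. R (Suc t) v + Q (Suc t) v) \<le> (\<Sum>v\<in>S. R t v + Q t v)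
    + (if cur t \<in> S then 1 / 2 ^ Suc t else 0)
    + (if cur t \<notin> S \<and> cur t div 2 \<in> S then rel t else 0)"
proof -
  have "R (Suc t) v + Q (Suc t) v \<le> R t v + Q t v
      + (if v = cur t then 1 / 2 ^ Suc t - rel t else 0) + (if v = cur t div 2 then rel t else 0)" for v
    unfolding R_Suc Q_Suc by (auto intro: add_nonneg_nonneg)
  then have "(\<Sum>v\<in>S. R (Suc t) v + Q (Suc t) v) \<le> (\<Sum>v\<in>S. R t v + Q t v
      + (if v = cur t then 1 / 2 ^ Suc t - rel t else 0) + (if v = cur t div 2 then rel t else 0))"
    by (intro sum_mono)
  also have "\<dots> = (\<Sum>v\<in>S. R t v + Q t v) + (if cur t \<in> S then 1 / 2 ^ Suc t - rel t else 0)
      + (if cur t div 2 \<in> S then rel t else 0)"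
    using S(1) by (simp add: sum.distrib)
  also have "\<dots> \<le> (\<Sum>v\<in>S. R t v + Q t v) + (if cur t \<in> S then 1 / 2 ^ Suc t else 0)
    + (if cur t \<notin> S \<and> cur t div 2 \<in> S then rel t else 0)"
    using S(2) by auto
  finally show ?thesis .
qed

lemma total_mass: "finite S \<Longrightarrow> (\<Sum>v\<in>S. R t v + Q t v) \<le> 1 - 1 / 2 ^ t"
proof (induction t arbitrary: S)
  case 0
  then show ?case by (simp add: R_def Q_def)
next
  case (Suc t)
  \<comment> \<open>Adding the visited node and its parent gives the closure that
    \<open>mass_step\<close> asks for.\<close>
  let ?S = "S \<union> {cur t, cur t div 2}"
  have "(\<Sum>v\<in>S. R (Suc t) v + Q (Suc t) v) \<le> (\<Sum>v\<in>?S. R (Suc t) v + Q (Suc t) v)"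
    using Suc.prems by (intro sum_mono2) auto
  also have "\<dots> \<le> (\<Sum>v\<in>?S. R t v + Q t v) + 1 / 2 ^ Suc t"
    using mass_step[of ?S t] Suc.prems by simp
  also have "\<dots> \<le> 1 - 1 / 2 ^ t + 1 / 2 ^ Suc t" using Suc.IH[of ?S] Suc.prems by simp
  also have "\<dots> = 1 - 1 / 2 ^ Suc t" by (simp add: field_simps)
  finally show ?case .
qed

section \<open>The true path\<close>

definition stable :: "nat \<Rightarrow> nat \<Rightarrow> bool" where
  "stable T w \<longleftrightarrow> (\<forall>t\<ge>T. \<not> right_of w (cur t))"

text \<open>This is the true path: the nodes visited infinitely often and cancelled only finitely
  often.\<close>

definition live :: "nat \<Rightarrow> bool" where
  "live w \<longleftrightarrow> 0 < w \<and> (\<exists>T. stable T w) \<and> (\<forall>T. \<exists>t\<ge>T. cur t = w)"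

lemma stable_pre: "stable T w \<Longrightarrow> pre v w \<Longrightarrow> stable T v"
  unfolding stable_def using right_of_mono by blast

lemma stable_later: "stable T w \<Longrightarrow> T \<le> T' \<Longrightarrow> stable T' w"
  unfolding stable_def by auto

lemma stableD: "stable T w \<Longrightarrow> T \<le> t \<Longrightarrow> \<not> right_of w (cur t)"
  unfolding stable_def by blast

lemma lst_mono: "stable T w \<Longrightarrow> T \<le> t \<Longrightarrow> t \<le> t' \<Longrightarrow> lst t w \<le> lst t' w"
proof (rotate_tac 2, induction t' rule: dec_induct)
  case (step n)
  then show ?case using lst_le[of n w] by (auto simp: lst_Suc stable_def)
qed simp

lemma cnt_mono: "stable T w \<Longrightarrow> T \<le> t \<Longrightarrow> t \<le> t' \<Longrightarrow> cnt t w \<le> cnt t' w"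
proof (rotate_tac 2, induction t' rule: dec_induct)
  case (step n)
  then show ?case by (auto simp: cnt_Suc stable_def)
qed simp

lemma lst_const:
  assumes "stable T w" "T \<le> a" "a \<le> t" "\<And>u. a \<le> u \<Longrightarrow> u < t \<Longrightarrow> cur u \<noteq> w"
  shows "lst t w = lst a w"
  using assms(3,4)
proof (induction t rule: dec_induct)
  case (step n)
  then have "lst (Suc n) w = lst n w" using stableD[OF assms(1), of n] assms(2) by (auto simp: lst_Suc)
  then show ?case using step by simp
qed simp

lemma lst_ge_visit:
  assumes "stable T w" "T \<le> u" "cur u = w" "u < t" shows "Suc u \<le> lst t w"
proof -
  have "lst (Suc u) w = Suc u" using assms by (simp add: lst_Suc)
  then show ?thesis using lst_mono[OF assms(1), of "Suc u" t] assms by simp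
qed

lemma lst_unbounded: "live w \<Longrightarrow> \<exists>T. \<forall>t\<ge>T. m \<le> lst t w"
proof -
  assume "live w"
  then obtain T where T: "stable T w" unfolding live_def by blast
  obtain u where u: "u \<ge> max T m" "cur u = w" using \<open>live w\<close> unfolding live_def by blast
  have "m \<le> lst t w" if "Suc u \<le> t" for t
    using lst_ge_visit[OF T _ u(2), of t] u that by simp
  then show ?thesis by blast
qed

text \<open>Without returns to the root every step descends to a child, so \<open>cur\<close> grows
  strictly, while \<open>next_cur\<close> keeps it at most the constant
  \<open>lst T 1\<close>.\<close>

lemma root_visited: "\<exists>t\<ge>T. cur t = 1"
proof (rule ccontr)
  assume "\<not> ?thesis"
  then have no: "\<And>t. T \<le> t \<Longrightarrow> cur t \<noteq> 1" by blast
  have st: "stable T 1" unfolding stable_def by (simp add: not_right_of_small)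
  have const: "lst (T + j) 1 = lst T 1" for j
    by (rule lst_const[OF st]) (use no in auto)
  have grow: "j < cur (T + j)" for j
  proof (induction j)
    case (Suc j)
    then show ?case using cur_Suc_cases[of "T + j"] no[of "Suc (T + j)"] by force
  qed simp
  have "cur (T + Suc j) \<le> lst T 1" for j
    using no[of "Suc (T + j)"] const[of j] by (auto simp: state_Suc next_cur_def split: if_splits)
  then show False using grow[of "Suc (lst T 1)"] by (metis Suc_lessD leD)
qed

lemma live_root: "live 1"
  unfolding live_def stable_def using root_visited by (simp add: not_right_of_small)

text \<open>The test in \<open>next_child\<close> was passed one step earlier, at \<open>v\<close>;
  visiting \<open>v\<close> leaves the entry of its child alone, and \<open>L\<close> is
  monotone.\<close>

lemma cur_even:
  assumes "cur t = 2 * v" "0 < v" shows "lst t (2 * v) < L (depth v) t"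
proof (cases t)
  case (Suc u)
  have "cur t \<noteq> 1" using assms by presburger
  then have c: "cur u = v" using cur_Suc_half[of u] Suc assms by simp
  then have "lst u (2 * v) < L (depth v) u"
    using assms Suc \<open>cur t \<noteq> 1\<close> by (auto simp: state_Suc next_cur_def next_child_def split: if_splits)
  moreover have "lst t (2 * v) = lst u (2 * v)"
  proof -
    have "\<not> right_of (2 * v) v" using right_of_double[of v v] by auto
    then show ?thesis using c Suc assms by (simp add: lst_Suc)
  qed
  ultimately show ?thesis using L_mono[of u t "depth v"] Suc by simp
qed (use assms in simp)

text \<open>Once \<open>lst t 1\<close> reaches the larger child of \<open>v\<close>, the depth
  limit no longer sends a descent at \<open>v\<close> back to the root.\<close>

lemma live_visits_child:
  assumes "live v" shows "\<exists>t\<ge>T. cur t = v \<and> cur (Suc t) \<in> {2 * v, 2 * v + 1}"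
proof -
  obtain T' where T': "\<And>t. T' \<le> t \<Longrightarrow> 2 * v + 1 \<le> lst t 1" using lst_unbounded[OF live_root] by blast
  obtain t where t: "t \<ge> max T T'" "cur t = v" using assms unfolding live_def by blast
  have "cur (Suc t) \<in> {2 * v, 2 * v + 1}"
    using T'[of t] t by (auto simp: state_Suc next_cur_def next_child_def)
  then show ?thesis using t by auto
qed

text \<open>Were \<open>2 * v\<close> abandoned, its \<open>lst\<close> entry would freeze, the
  unbounded \<open>L\<close> would pass it, and a later visit of \<open>v\<close> would go
  left.\<close>

lemma live_even_child:
  assumes v: "live v" and L: "\<And>m. \<exists>t. m \<le> L (depth v) t" shows "live (2 * v)"
proof -
  obtain T where T: "stable T v" using v unfolding live_def by blast
  have st: "stable T (2 * v)" using T right_of_double unfolding stable_def by blast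
  moreover have "\<exists>t\<ge>T'. cur t = 2 * v" for T'
  proof (rule ccontr)
    assume "\<not> ?thesis"
    then have no: "\<And>t. T' \<le> t \<Longrightarrow> cur t \<noteq> 2 * v" by blast
    define T0 where "T0 = max T T'"
    have const: "lst (T0 + j) (2 * v) = lst T0 (2 * v)" for j
      by (rule lst_const[OF st]) (use no in \<open>auto simp: T0_def\<close>)
    obtain t1 where t1: "Suc (lst T0 (2 * v)) \<le> L (depth v) t1" using L by blast
    obtain T2 where T2: "\<And>t. T2 \<le> t \<Longrightarrow> 2 * v + 1 \<le> lst t 1" using lst_unbounded[OF live_root] by blast
    obtain t where t: "t \<ge> max T0 (max t1 T2)" "cur t = v" using v unfolding live_def by blast
    have "lst t (2 * v) < L (depth v) t"
      using const[of "t - T0"] t t1 L_mono[of t1 t "depth v"] by simp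
    then have "cur (Suc t) = 2 * v"
      using T2[of t] t by (auto simp: state_Suc next_cur_def next_child_def)
    then show False using no[of "Suc t"] t by (simp add: T0_def)
  qed
  ultimately show ?thesis using v unfolding live_def by auto
qed

text \<open>A late visit of \<open>2 * v\<close> makes its \<open>lst\<close> entry exceed the bound
  \<open>B\<close>, so no further visit follows. From then on descents at \<open>v\<close> that are
  not cut off go right.\<close>

lemma live_odd_child:
  assumes v: "live v" and L: "\<And>t. L (depth v) t \<le> B" shows "live (2 * v + 1)"
proof -
  obtain T where T: "stable T v" using v unfolding live_def by blast
  have v0: "0 < v" using v by (simp add: live_def)
  have st: "stable T (2 * v)" using T right_of_double unfolding stable_def by blast
  have "\<exists>T1. \<forall>t\<ge>T1. cur t \<noteq> 2 * v"
  proof (rule ccontr)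
    assume "\<not> ?thesis"
    then have inf: "\<And>T1. \<exists>t\<ge>T1. cur t = 2 * v" by blast
    obtain t1 where t1: "t1 \<ge> max T B" "cur t1 = 2 * v" using inf by blast
    obtain t2 where t2: "t2 \<ge> Suc t1" "cur t2 = 2 * v" using inf by blast
    show False
      using lst_ge_visit[OF st _ t1(2), of t2] cur_even[OF t2(2) v0] L[of t2] t1 t2 by simp
  qed
  then obtain T1 where T1: "\<And>t. T1 \<le> t \<Longrightarrow> cur t \<noteq> 2 * v" by blast
  \<comment> \<open>A descent under way may still be below \<open>2 * v\<close>. A visit of the root
    ends it, and the subtree can be entered again only through \<open>2 * v\<close>.\<close>
  obtain T2 where T2: "T2 \<ge> max T T1" "cur T2 = 1" using root_visited by blast
  have np: "\<not> pre (2 * v) (cur t)" if "T2 \<le> t" for t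
    using that
  proof (induction t rule: dec_induct)
    case base
    then show ?case using T2 v0 by (auto dest: pre_le)
  next
    case (step t)
    show ?case
    proof
      assume p: "pre (2 * v) (cur (Suc t))"
      then have "cur (Suc t) \<noteq> 1" using v0 by (auto dest: pre_le)
      then have "cur (Suc t) div 2 = cur t" by (rule cur_Suc_half)
      then show False using p pre_cases[of "2 * v" "cur (Suc t)"] step T1[of "Suc t"] T2 by auto
    qed
  qed
  have "stable T2 (2 * v + 1)"
    unfolding stable_def
  proof (intro allI impI)
    fix t assume "T2 \<le> t"
    then show "\<not> right_of (2 * v + 1) (cur t)"
      using right_of_double_Suc np stableD[OF T, of t] T2 by auto
  qed
  moreover have "\<exists>t\<ge>T'. cur t = 2 * v + 1" for T'
  proof -
    obtain t where "t \<ge> max T' T1" "cur (Suc t) \<in> {2 * v, 2 * v + 1}"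
      using live_visits_child[OF v] by blast
    then show ?thesis using T1[of "Suc t"] by (intro exI[of _ "Suc t"]) auto
  qed
  ultimately show ?thesis unfolding live_def by auto
qed

lemma depth_child: "0 < v \<Longrightarrow> depth (2 * v) = Suc (depth v)" "0 < v \<Longrightarrow> depth (2 * v + 1) = Suc (depth v)"
  by (subst depth.simps, simp)+

lemma live_at_depth: "\<exists>v. live v \<and> depth v = e"
proof (induction e)
  case 0
  then show ?case using live_root by (intro exI[of _ 1]) (simp add: depth.simps)
next
  case (Suc e)
  then obtain v where v: "live v" "depth v = e" by blast
  then have "0 < v" by (simp add: live_def)
  show ?case
  proof (cases "\<forall>m. \<exists>t. m \<le> L (depth v) t")
    case True
    then show ?thesis using live_even_child[OF v(1)] v(2) depth_child[OF \<open>0 < v\<close>] by blast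
  next
    case False
    then obtain B where "\<And>t. L (depth v) t \<le> B" by (meson nat_le_linear)
    then show ?thesis using live_odd_child[OF v(1)] v(2) depth_child[OF \<open>0 < v\<close>] by blast
  qed
qed

lemma live_parent: "live w \<Longrightarrow> w \<noteq> 1 \<Longrightarrow> live (w div 2)"
proof -
  assume w: "live w" "w \<noteq> 1"
  have "\<exists>t\<ge>T. cur t = w div 2" for T
  proof -
    obtain t where t: "t \<ge> Suc T" "cur t = w" using w unfolding live_def by blast
    then obtain u where "t = Suc u" by (cases t) auto
    then show ?thesis using t w cur_Suc_half[of u] by auto
  qed
  then show ?thesis using w stable_pre[OF _ pre_div2] unfolding live_def by force
qed

lemma live_anc: "live w \<Longrightarrow> v \<in> anc w \<Longrightarrow> live v"
proof (induction w rule: less_induct)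
  case (less w)
  then have w: "pre v w" "v \<noteq> w" "0 < v" by (auto simp: anc_def)
  then have p: "pre v (w div 2)" using pre_cases by blast
  have "w \<noteq> 1" "0 < w" using w p pre_le[of v "w div 2"] by auto
  then have lp: "live (w div 2)" using live_parent less.prems by blast
  show ?case
  proof (cases "v = w div 2")
    case False
    then have "v \<in> anc (w div 2)" using p w by (simp add: anc_def)
    then show ?thesis using less.IH[of "w div 2"] lp \<open>0 < w\<close> by simp
  qed (use lp in simp)
qed

section \<open>Convergence of the mass along the true path\<close>

definition X :: "nat \<Rightarrow> real" where "X t = R t 0"

text \<open>
  This potential is eventually nondecreasing, and bounded, along the true path; so the mass of a node,
  a difference of two potentials, converges.
\<close>

definition path_mass :: "nat \<Rightarrow> nat \<Rightarrow> real" where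
  "path_mass w t = (\<Sum>v\<in>{v. pre v w}. R t v)"

lemma path_mass_0: "path_mass 0 t = X t"
proof -
  have "{v. pre v 0} = {0}" by (auto dest: pre_le)
  then show ?thesis by (simp add: path_mass_def X_def)
qed

lemma path_mass_half: "0 < w \<Longrightarrow> path_mass w t = R t w + path_mass (w div 2) t"
proof -
  assume "0 < w"
  then have "{v. pre v w} = insert w {v. pre v (w div 2)}" "\<not> pre w (w div 2)"
    using pre_cases[of _ w] by (auto dest: pre_le)
  then show ?thesis by (simp add: path_mass_def)
qed

text \<open>Transport from a prefix of \<open>w\<close> ends in a prefix again, and transport from
  outside can only add \<open>rel t\<close>; the hypothesis excludes the cancellation of any
  prefix.\<close>

lemma path_mass_Suc:
  assumes "\<not> right_of w (cur t)"
  shows "path_mass w t + (if \<not> pre (cur t) w \<and> pre (cur t div 2) w then rel t else 0) \<le> path_mass w (Suc t)"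
proof -
  have "R t v + (if v = cur t then - rel t else 0) + (if v = cur t div 2 then rel t else 0) \<le> R (Suc t) v"
    if "pre v w" for v
    using right_of_mono[OF _ that] assms unfolding R_Suc by auto
  then have "(\<Sum>v\<in>{v. pre v w}. R t v + (if v = cur t then - rel t else 0)
      + (if v = cur t div 2 then rel t else 0)) \<le> path_mass w (Suc t)"
    unfolding path_mass_def by (intro sum_mono) auto
  also have "(\<Sum>v\<in>{v. pre v w}. R t v + (if v = cur t then - rel t else 0)
      + (if v = cur t div 2 then rel t else 0)) = path_mass w t
      + (if pre (cur t) w then - rel t else 0) + (if pre (cur t div 2) w then rel t else 0)"
    by (simp add: sum.distrib path_mass_def)
  finally show ?thesis using pre_trans[OF pre_div2, of "cur t" w] by (auto split: if_splits)
qed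

lemma path_mass_Suc_le:
  assumes "\<not> right_of w (cur t)" shows "path_mass w t \<le> path_mass w (Suc t)"
proof -
  have "path_mass w t \<le> path_mass w t + (if \<not> pre (cur t) w \<and> pre (cur t div 2) w then rel t else 0)"
    by simp
  also note path_mass_Suc[OF assms]
  finally show ?thesis .
qed

lemma path_mass_mono:
  assumes "stable T w" "T \<le> t" "t \<le> t'" shows "path_mass w t \<le> path_mass w t'"
  using assms(3)
proof (induction t' rule: dec_induct)
  case (step n)
  have "path_mass w n \<le> path_mass w (Suc n)"
    using stableD[OF assms(1), of n] step assms(2) by (intro path_mass_Suc_le) simp
  then show ?case using step by simp
qed simp

lemma path_mass_le_1: "path_mass w t \<le> 1"
proof -
  have "path_mass w t \<le> (\<Sum>v\<in>{v. pre v w}. R t v + Q t v)"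
    unfolding path_mass_def by (intro sum_mono) simp
  also have "\<dots> \<le> 1" using total_mass[OF finite_pre[of w], of t] by (simp add: order_trans)
  finally show ?thesis .
qed

lemma path_mass_convergent:
  assumes "stable T w" shows "convergent (path_mass w)"
proof -
  have "incseq (\<lambda>t. path_mass w (t + T))"
    by (rule incseq_SucI) (rule path_mass_mono[OF assms]; simp)
  then obtain l where "(\<lambda>t. path_mass w (t + T)) \<longlonglongrightarrow> l"
    using incseq_convergent path_mass_le_1 by blast
  then show ?thesis unfolding convergent_def using LIMSEQ_offset by blast
qed

lemma stable_0: "stable 0 0"
  unfolding stable_def by (simp add: not_right_of_small)

lemma X_mono: "mono X"
  using path_mass_mono[OF stable_0] by (intro monoI) (simp add: path_mass_0)

lemma X_convergent: "convergent X"
proof -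
  have "path_mass 0 = X" by (rule ext) (rule path_mass_0)
  then show ?thesis using path_mass_convergent[OF stable_0] by simp
qed

lemma Q_tendsto_0: "live w \<Longrightarrow> (\<lambda>t. Q t w) \<longlonglongrightarrow> 0"
proof (rule LIMSEQ_I)
  fix r :: real assume w: "live w" and "0 < r"
  obtain m where m: "(1/2) ^ m < r" using \<open>0 < r\<close> real_arch_pow_inv[of r "1/2"] by auto
  obtain T where T: "\<And>t. T \<le> t \<Longrightarrow> m \<le> lst t w" using lst_unbounded[OF w] by blast
  have "norm (Q t w - 0) < r" if "T \<le> t" for t
  proof -
    have "Q t w \<le> (1/2) ^ lst t w" by (simp add: Q_def power_divide)
    also have "\<dots> \<le> (1/2) ^ m" using T[OF that] by (intro power_decreasing) auto
    finally show ?thesis using m by simp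
  qed
  then show "\<exists>T. \<forall>t\<ge>T. norm (Q t w - 0) < r" by blast
qed

text \<open>While the count rests at \<open>m\<close>, the threshold \<open>1 / Suc m\<close> for
  effective visits is fixed, and the mass of the ancestors eventually falls below it.\<close>

lemma cnt_unbounded:
  assumes w: "live w" and st: "stable T w" and anc: "(\<lambda>t. \<Sum>u\<in>anc w. R t u + Q t u) \<longlonglongrightarrow> 0"
  shows "\<exists>t\<ge>T. m \<le> cnt t w"
proof (induction m)
  case (Suc m)
  then obtain t where t: "T \<le> t" "m \<le> cnt t w" by blast
  show ?case
  proof (cases "Suc m \<le> cnt t w")
    case False
    then have m: "cnt t w = m" using t by simp
    have "eventually (\<lambda>t. (\<Sum>u\<in>anc w. R t u + Q t u) < 1 / real (Suc m)) sequentially"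
      using order_tendstoD(2)[OF anc, of "1 / real (Suc m)"] by simp
    then obtain T1 where T1: "\<And>t. T1 \<le> t \<Longrightarrow> (\<Sum>u\<in>anc w. R t u + Q t u) < 1 / real (Suc m)"
      unfolding eventually_sequentially by blast
    obtain u where u: "max t T1 \<le> u" "cur u = w" using w unfolding live_def by blast
    show ?thesis
    proof (cases "cnt u w = m")
      case True
      then have "eff u" using eff_iff[of u] T1[of u] u by simp
      then have "cnt (Suc u) w = Suc m" using True u by (simp add: cnt_Suc)
      then show ?thesis using u t by (intro exI[of _ "Suc u"]) simp
    next
      case False
      then have "Suc m \<le> cnt u w" using cnt_mono[OF st, of t u] u t m by simp
      then show ?thesis using u t by (intro exI[of _ u]) simp
    qed
  qed (use t in blast)
qed auto

text \<open>Truncation at \<open>c\<close> changes only finitely many terms of a multiple of the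
  harmonic series.\<close>

lemma not_bounded_min_harmonic:
  assumes "0 < (c::real)" shows "\<exists>n. B < (\<Sum>j<n. min c (1 / (2 * real (Suc j))))"
proof (rule ccontr)
  assume "\<not> ?thesis"
  then have "\<And>n. (\<Sum>j<n. min c (1 / (2 * real (Suc j)))) \<le> B" by (meson not_le)
  then have "summable (\<lambda>j. min c (1 / (2 * real (Suc j))))"
    using assms by (intro summableI_nonneg_bounded) auto
  moreover have "eventually (\<lambda>j. min c (1 / (2 * real (Suc j))) = 1 / (2 * real (Suc j))) sequentially"
  proof -
    have "(\<lambda>j. 1 / (2 * real (Suc j))) \<longlonglongrightarrow> 0" by real_asymp
    then have "eventually (\<lambda>j. 1 / (2 * real (Suc j)) < c) sequentially"
      using order_tendstoD(2) assms by blast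
    then show ?thesis by eventually_elim simp
  qed
  ultimately have "summable (\<lambda>j. 1 / (2 * real (Suc j)))" by (simp only: summable_cong)
  then have "summable (\<lambda>j. 2 * (1 / (2 * real (Suc j))))" by (rule summable_mult)
  moreover have "2 * (1 / (2 * real (Suc j))) = inverse (real (Suc j))" for j
    by (simp add: field_simps)
  ultimately have "summable (\<lambda>j. inverse (real (Suc j)))" by (simp only:)
  then show False using not_summable_harmonic[where 'a = real] summable_Suc_iff[of "\<lambda>n. inverse (real n)"] by simp
qed

text \<open>By induction the ancestors empty out, so effective visits never cease. If the mass of
  \<open>w\<close> had a limit \<open>c > 0\<close>, late effective visits with count
  \<open>j\<close> would each pass at least \<open>min (c / 2) (1 / (2 * Suc j))\<close> into the
  bounded potential of \<open>w div 2\<close>, contradicting the divergence of the harmonic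
  series.\<close>

lemma R_tendsto_0: "live w \<Longrightarrow> (\<lambda>t. R t w) \<longlonglongrightarrow> 0"
proof (induction w rule: less_induct)
  case (less w)
  note w = less.prems
  have w0: "0 < w" using w by (simp add: live_def)
  obtain T where T: "stable T w" using w unfolding live_def by blast
  have anc: "(\<lambda>t. \<Sum>u\<in>anc w. R t u + Q t u) \<longlonglongrightarrow> 0"
  proof (rule tendsto_null_sum)
    fix u assume u: "u \<in> anc w"
    then have "u < w" by (auto simp: anc_def dest: pre_le intro: le_neq_implies_less)
    then show "(\<lambda>t. R t u + Q t u) \<longlonglongrightarrow> 0"
      using tendsto_add[OF less.IH Q_tendsto_0] live_anc[OF w u] by fastforce
  qed
  obtain l1 l2 where "path_mass w \<longlonglongrightarrow> l1" "path_mass (w div 2) \<longlonglongrightarrow> l2"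
    using path_mass_convergent[OF T] path_mass_convergent[OF stable_pre[OF T pre_div2]]
    unfolding convergent_def by blast
  then have "(\<lambda>t. path_mass w t - path_mass (w div 2) t) \<longlonglongrightarrow> l1 - l2" by (rule tendsto_diff)
  then have lim: "(\<lambda>t. R t w) \<longlonglongrightarrow> l1 - l2" using path_mass_half[OF w0] by simp
  define c where "c = l1 - l2"
  have "0 \<le> c" unfolding c_def by (rule LIMSEQ_le_const[OF lim]) simp
  moreover have "\<not> 0 < c"
  proof
    assume c: "0 < c"
    obtain T1 where T1: "\<And>t. T1 \<le> t \<Longrightarrow> c / 2 < R t w"
      using order_tendstoD(1)[OF lim, of "c / 2"] c unfolding eventually_sequentially c_def by auto
    define T2 where "T2 = max T T1"
    let ?h = "\<lambda>n. \<Sum>j<n. min (c / 2) (1 / (2 * real (Suc j)))"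
    \<comment> \<open>The difference of the two \<open>?h\<close> values collects the lower bounds
      for all releases at effective visits from \<open>T2\<close> to \<open>t\<close>.\<close>
    have "path_mass (w div 2) T2 + (?h (cnt t w) - ?h (cnt T2 w)) \<le> path_mass (w div 2) t" if "T2 \<le> t" for t
      using that
    proof (induction t rule: dec_induct)
      case (step t)
      have nr: "\<not> right_of w (cur t)" "\<not> right_of (w div 2) (cur t)"
        using stableD[OF T, of t] stableD[OF stable_pre[OF T pre_div2], of t] step by (auto simp: T2_def)
      have mono: "path_mass (w div 2) t \<le> path_mass (w div 2) (Suc t)"
        by (rule path_mass_Suc_le[OF nr(2)])
      show ?case
      proof (cases "cur t = w \<and> eff t")
        case True
        then have "path_mass (w div 2) t + rel t \<le> path_mass (w div 2) (Suc t)"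
        proof -
          have "\<not> pre w (w div 2)" using w0 by (auto dest: pre_le)
          then show ?thesis using path_mass_Suc[OF nr(2)] True by simp
        qed
        moreover have "min (c / 2) (1 / (2 * real (Suc (cnt t w)))) \<le> rel t"
          using rel_ge[of t] T1[of t] True step unfolding T2_def by auto
        moreover have "cnt (Suc t) w = Suc (cnt t w)" using True nr by (auto simp: cnt_Suc)
        ultimately show ?thesis using step.IH by (simp del: of_nat_Suc)
      next
        case False
        then have "cnt (Suc t) w = cnt t w" using nr by (auto simp: cnt_Suc)
        then show ?thesis using mono step.IH by simp
      qed
    qed simp
    moreover have "0 \<le> path_mass (w div 2) T2" unfolding path_mass_def by (intro sum_nonneg) simp
    ultimately have bound: "?h (cnt t w) \<le> 1 + ?h (cnt T2 w)" if "T2 \<le> t" for t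
      using that path_mass_le_1[of "w div 2" t] by fastforce
    obtain n where n: "1 + ?h (cnt T2 w) < ?h n" using not_bounded_min_harmonic[of "c / 2"] c by auto
    obtain t where t: "t \<ge> T2" "n \<le> cnt t w"
      using cnt_unbounded[OF w stable_later[OF T] anc, of T2 n] by (auto simp: T2_def)
    have "?h n \<le> ?h (cnt t w)" using t(2) c by (intro sum_mono2) auto
    then show False using bound[OF t(1)] n by simp
  qed
  ultimately have "c = 0" by simp
  then show ?case using lim by (simp add: c_def)
qed

definition x_lim :: real where "x_lim = lim X"

lemma X_tendsto: "X \<longlonglongrightarrow> x_lim"
  unfolding x_lim_def using X_convergent by (simp add: convergent_LIMSEQ_iff)

text \<open>Consecutive potentials on the path differ by the mass of one node, which vanishes, so
  all share the limit of \<open>X\<close>.\<close>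

lemma path_mass_tendsto: "live w \<Longrightarrow> path_mass w \<longlonglongrightarrow> x_lim"
proof (induction w rule: less_induct)
  case (less w)
  have w0: "0 < w" using less.prems by (simp add: live_def)
  have "path_mass (w div 2) \<longlonglongrightarrow> x_lim"
  proof (cases "w = 1")
    case True
    then have "path_mass (w div 2) = X" by (simp add: path_mass_0 fun_eq_iff)
    then show ?thesis using X_tendsto by simp
  next
    case False
    then show ?thesis using less.IH[of "w div 2"] live_parent[OF less.prems] w0 by simp
  qed
  from tendsto_add[OF R_tendsto_0[OF less.prems] this]
  show ?case using path_mass_half[OF w0] by (simp add: fun_eq_iff[symmetric] ext)
qed

lemma path_mass_ge_X: "0 < w \<Longrightarrow> X t + R t w \<le> path_mass w t"
proof -
  assume "0 < w"
  then have "X t + R t w = (\<Sum>v\<in>{0, w}. R t v)" by (simp add: X_def)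
  also have "\<dots> \<le> path_mass w t"
    unfolding path_mass_def by (intro sum_mono2) auto
  finally show ?thesis .
qed

text \<open>The potential increases to \<open>x_lim\<close> and contains both \<open>X\<close> and
  the mass of \<open>w\<close>; what is active at \<open>w\<close> is therefore still to
  come.\<close>

lemma R_le_remaining:
  assumes "live w" "stable T w" "T \<le> t" shows "R t w \<le> x_lim - X t"
proof -
  have "path_mass w t \<le> x_lim"
    using path_mass_mono[OF assms(2,3)] by (intro LIMSEQ_le_const[OF path_mass_tendsto[OF assms(1)]]) blast
  then show ?thesis using path_mass_ge_X[of w t] assms(1) by (simp add: live_def)
qed

lemma R_mono_unvisited:
  assumes "stable T w" "T \<le> a" "a \<le> t" "\<And>u. a \<le> u \<Longrightarrow> u < t \<Longrightarrow> cur u \<noteq> w"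
  shows "R a w \<le> R t w"
  using assms(3,4)
proof (induction t rule: dec_induct)
  case (step n)
  then have "R n w \<le> R (Suc n) w" using stableD[OF assms(1), of n] assms(2) by (auto simp: R_Suc)
  then show ?case using step by force
qed simp

text \<open>
  Between consecutive visits \<open>t\<^sub>1 < t\<^sub>2\<close> the node holds the mass created at the visit preceding \<open>t\<^sub>1\<close>; this
  covers all \<open>n\<close> between that visit and \<open>t\<^sub>1\<close>, for which convergence is known at \<open>t\<^sub>2\<close>.
\<close>

lemma slow_convergence:
  assumes v: "live v" and L: "\<And>m. \<exists>t. m \<le> L (depth v) t"
  shows "\<exists>n0. \<forall>n\<ge>n0. \<exists>t. n < L (depth v) t \<and> 2 / 2 ^ n \<le> x_lim - X t"
proof -
  \<comment> \<open>The visits that matter are those of the left child, since each of them certifies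
    convergence.\<close>
  define w where "w = 2 * v"
  have w: "live w" unfolding w_def by (rule live_even_child[OF v L])
  have v0: "0 < v" using v by (simp add: live_def)
  obtain T where T: "stable T w" using w unfolding live_def by blast
  have vis: "\<exists>t\<ge>T'. cur t = w" for T' using w unfolding live_def by blast
  obtain u1 where u1: "u1 \<ge> T" "cur u1 = w" using vis by blast
  have "\<exists>t. n < L (depth v) t \<and> 2 / 2 ^ n \<le> x_lim - X t" if n: "Suc (Suc u1) \<le> n" for n
  proof -
    \<comment> \<open>The shift by one makes the mass bound \<open>1 / 2 ^ m\<close> equal to the
      required \<open>2 / 2 ^ n\<close>.\<close>
    define m where "m = n - 1"
    have m: "Suc u1 \<le> m" "n = Suc m" using n by (auto simp: m_def)
    define t1 where "t1 = (LEAST t. m \<le> t \<and> cur t = w)"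
    have t1: "m \<le> t1" "cur t1 = w"
      using LeastI_ex[of "\<lambda>t. m \<le> t \<and> cur t = w"] vis[of m] unfolding t1_def by auto
    define t2 where "t2 = (LEAST t. Suc t1 \<le> t \<and> cur t = w)"
    have t2: "Suc t1 \<le> t2" "cur t2 = w"
      using LeastI_ex[of "\<lambda>t. Suc t1 \<le> t \<and> cur t = w"] vis[of "Suc t1"] unfolding t2_def by auto
    have between: "cur u \<noteq> w" if "Suc t1 \<le> u" "u < t2" for u
      using not_less_Least[of u "\<lambda>t. Suc t1 \<le> t \<and> cur t = w"] that unfolding t2_def by auto
    have "Suc u1 \<le> lst t1 w" by (rule lst_ge_visit[OF T u1(1) u1(2)]) (use m t1 in simp)
    then obtain u where u: "lst t1 w = Suc u" by (cases "lst t1 w") auto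
    have "u < m"
    proof (rule ccontr)
      assume "\<not> u < m"
      then have "t1 \<le> u" unfolding t1_def using lst_visited[OF u] by (intro Least_le) auto
      then show False using lst_visited[OF u] by simp
    qed
    have "1 / 2 ^ m \<le> (1 / 2 ^ Suc u :: real)"
      using \<open>u < m\<close> by (intro divide_left_mono power_increasing) auto
    also have "\<dots> = Q t1 w" using u by (simp add: Q_def)
    also have "\<dots> \<le> R (Suc t1) w"
      using stableD[OF T, of t1] t1 u1 m rel_le[of t1] half_cur_less[of t1] by (simp add: R_Suc)
    also have "\<dots> \<le> R t2 w"
      by (rule R_mono_unvisited[OF T _ t2(1) between]) (use t1 u1 m in auto)
    also have "\<dots> \<le> x_lim - X t2"
      by (rule R_le_remaining[OF w T]) (use t1 t2 u1 m in auto)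
    finally have "2 / 2 ^ n \<le> x_lim - X t2" using m by simp
    \<comment> \<open>The visit at \<open>t2\<close> certifies convergence beyond the one at
      \<open>t1\<close>, and \<open>n \<le> Suc t1\<close>.\<close>
    moreover have "n < L (depth v) t2"
      using cur_even[of t2 v] t2(2) v0 lst_ge_visit[OF T _ t1(2), of t2] t1 t2 u1 m unfolding w_def by simp
    ultimately show ?thesis by blast
  qed
  then show ?thesis by blast
qed

text \<open>
  The mass outside the subtree of \<open>w\<close> bounds the growth of \<open>X\<close>: nodes to the left are no longer visited,
  nodes to the right are empty after \<open>a\<close>, the ancestors hold little, and \<open>w\<close> itself releases mass only at \<open>a\<close>.
\<close>

lemma effective_interval:
  assumes T: "stable T w" "0 < w" and a: "T \<le> a" "cur a = w" "eff a" and b: "a < b" "cnt b w \<le> Suc (cnt a w)"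
  shows "X b \<le> X a + 3 / real (Suc (cnt a w))"
proof -
  define \<kappa> where "\<kappa> = cnt a w"
  \<comment> \<open>The cut-off \<open>b + w + 2\<close> keeps the region finite and exceeds every
    node visited before time \<open>b\<close>.\<close>
  define S where "S = {v. pre v w \<and> v \<noteq> w} \<union> {v. v < b + w + 2 \<and> right_of v w}"
  define G where "G t = (\<Sum>v\<in>S. R t v + Q t v)" for t
  have finS: "finite S" unfolding S_def by (auto intro: finite_subset[OF _ finite_pre[of w]])
  have S0: "0 \<in> S" using T(2) by (simp add: S_def)
  have nr: "\<not> right_of w (cur t)" if "a \<le> t" for t using stableD[OF T(1)] that a by simp
  have cnt_b: "cnt t w = Suc \<kappa>" if "a < t" "t \<le> b" for t
  proof -
    have "cnt (Suc a) w = Suc \<kappa>" using a by (simp add: cnt_Suc \<kappa>_def)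
    then show ?thesis
      using cnt_mono[OF T(1), of "Suc a" t] cnt_mono[OF T(1), of t b] a b that by (simp add: \<kappa>_def)
  qed
  \<comment> \<open>The visit at \<open>a\<close> has just emptied the nodes to the right. One
    summand \<open>1 / Suc \<kappa>\<close> is for the ancestors, by effectiveness, the other for
    the release at \<open>a\<close>.\<close>
  have start: "G (Suc a) \<le> X a + 2 / real (Suc \<kappa>)"
  proof -
    let ?P = "{v. pre v w \<and> v \<noteq> w}"
    have finP: "finite ?P" by (auto intro: finite_subset[OF _ finite_pre[of w]])
    have "G (Suc a) = (\<Sum>v\<in>?P. R (Suc a) v + Q (Suc a) v)"
      unfolding G_def
      by (rule sum.mono_neutral_right[OF finS]) (auto simp: S_def R_Suc Q_Suc a)
    also have "\<dots> \<le> (\<Sum>v\<in>?P. R a v + Q a v) + rel a"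
      using mass_step[OF finP, of a] a half_cur_less[of a] by simp
    also have "?P = insert 0 (anc w)" using T(2) by (auto simp: anc_def)
    also have "(\<Sum>v\<in>insert 0 (anc w). R a v + Q a v) = X a + Q a 0 + (\<Sum>v\<in>anc w. R a v + Q a v)"
      by (subst sum.insert) (auto simp: anc_def[of w] X_def)
    also have "Q a 0 = 0" using lst_visited[of a 0] cur_pos unfolding Q_def
      by (metis less_irrefl not0_implies_Suc)
    also have "(\<Sum>v\<in>anc w. R a v + Q a v) \<le> 1 / real (Suc \<kappa>)" using a eff_iff[of a] by (simp add: \<kappa>_def)
    also have "rel a \<le> 1 / real (Suc \<kappa>)" using rel_le_inverse[of a] a by (simp add: \<kappa>_def)
    finally show ?thesis by (simp add: add_divide_distrib[symmetric] del: of_nat_Suc)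
  qed
  have "G t \<le> G (Suc a) + (1 / 2 ^ Suc a - 1 / 2 ^ t)" if "Suc a \<le> t" "t \<le> b" for t
    using that
  proof (induction t rule: dec_induct)
    case (step t)
    let ?c = "cur t"
    have c_less: "?c < b + w + 2" using cur_le[of t] step by simp
    consider "pre ?c w" "?c \<noteq> w" | "?c = w" | "pre w ?c" "?c \<noteq> w" | "right_of ?c w"
      using tree_cases[of ?c w] T(2) nr[of t] step by auto
    then have "G (Suc t) \<le> G t + 1 / 2 ^ Suc t"
    proof cases
      case 1
      then have "?c \<in> S" "?c div 2 \<in> S"
        using pre_trans[OF pre_div2 1(1)] pre_le[OF 1(1)] cur_pos[of t] by (auto simp: S_def)
      then show ?thesis using mass_step[OF finS, of t] by (simp add: G_def)
    next
      case 2
      have "\<not> eff t"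
      proof
        assume "eff t"
        then have "cnt (Suc t) w = Suc (cnt t w)" using 2 by (simp add: cnt_Suc)
        then show False using cnt_b[of t] cnt_b[of "Suc t"] step by simp
      qed
      then have "rel t = 0" by (rule rel_not_eff)
      moreover have "?c \<notin> S" using 2 by (simp add: S_def)
      ultimately have "G (Suc t) \<le> G t" using mass_step[OF finS, of t] by (simp add: G_def split: if_splits)
      then show ?thesis by (smt (verit) zero_less_divide_1_iff zero_less_power)
    next
      case 3
      have p: "pre w (?c div 2)" using 3 pre_cases[of w ?c] by auto
      have "v \<notin> S" if "pre w v" for v
        using that right_of_not_pre(2)[of v w] pre_le[of w v] pre_le[of v w] by (auto simp: S_def)
      then have "?c \<notin> S" "?c div 2 \<notin> S" using 3 p by auto
      then have "G (Suc t) \<le> G t" using mass_step[OF finS, of t] by (simp add: G_def)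
      then show ?thesis by (smt (verit) zero_less_divide_1_iff zero_less_power)
    next
      case 4
      then have "?c \<in> S" using c_less by (simp add: S_def)
      moreover have "?c div 2 \<in> S" using right_of_parent[OF 4] c_less by (auto simp: S_def)
      ultimately show ?thesis using mass_step[OF finS, of t] by (simp add: G_def)
    qed
    moreover have "1 / 2 ^ t = 1 / 2 ^ Suc t + (1 / 2 ^ Suc t :: real)" by (simp add: field_simps)
    moreover have "G t \<le> G (Suc a) + (1 / 2 ^ Suc a - 1 / 2 ^ t)" using step by simp
    ultimately show ?case by linarith
  qed simp
  from this[of b] have "G b \<le> G (Suc a) + (1 / 2 ^ Suc a - 1 / 2 ^ b)" using b by simp
  \<comment> \<open>The mass created after \<open>a\<close> amounts to at most
    \<open>1 / 2 ^ Suc a\<close>, which the inequality \<open>\<kappa> \<le> a\<close> turns into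
    the third summand.\<close>
  also have "\<dots> \<le> G (Suc a) + 1 / real (Suc \<kappa>)"
  proof -
    have "Suc \<kappa> \<le> 2 ^ Suc a" using cnt_le[of a w] less_exp[of "Suc a"] unfolding \<kappa>_def by linarith
    then have "real (Suc \<kappa>) \<le> real (2 ^ Suc a)" by (simp only: of_nat_le_iff)
    then have "real (Suc \<kappa>) \<le> 2 ^ Suc a" by simp
    then have "1 / 2 ^ Suc a \<le> 1 / real (Suc \<kappa>)" by (intro divide_left_mono) auto
    moreover have "0 \<le> (1 / 2 ^ b :: real)" by simp
    ultimately show ?thesis by linarith
  qed
  also note start
  finally have "G b \<le> X a + 3 / real (Suc \<kappa>)" by (simp add: add_divide_distrib[symmetric] del: of_nat_Suc)
  moreover have "X b \<le> G b"
  proof -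
    have "X b \<le> R b 0 + Q b 0" by (simp add: X_def)
    also have "\<dots> \<le> G b" unfolding G_def using member_le_sum[OF S0, of "\<lambda>v. R b v + Q b v"] finS by simp
    finally show ?thesis .
  qed
  ultimately show ?thesis by (simp add: \<kappa>_def)
qed

lemma live_cnt_unbounded: "live w \<Longrightarrow> stable T w \<Longrightarrow> \<exists>t\<ge>T. m \<le> cnt t w"
proof (rule cnt_unbounded)
  assume w: "live w"
  have "(\<lambda>t. R t u + Q t u) \<longlonglongrightarrow> 0" if "u \<in> anc w" for u
    using tendsto_add[OF R_tendsto_0 Q_tendsto_0] live_anc[OF w that] by fastforce
  then show "(\<lambda>t. \<Sum>u\<in>anc w. R t u + Q t u) \<longlonglongrightarrow> 0" by (rule tendsto_null_sum)
qed

text \<open>After \<open>T\<close> the count rises by single steps and only at effective visits, so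
  it leaves every value at such a visit.\<close>

lemma effective_visit:
  assumes "live w" "stable T w" "cnt T w \<le> k"
  shows "\<exists>a\<ge>T. cur a = w \<and> eff a \<and> cnt a w = k"
proof -
  define b where "b = (LEAST t. T \<le> t \<and> Suc k \<le> cnt t w)"
  have b: "T \<le> b" "Suc k \<le> cnt b w"
    using LeastI_ex[of "\<lambda>t. T \<le> t \<and> Suc k \<le> cnt t w"] live_cnt_unbounded[OF assms(1,2), of "Suc k"]
    unfolding b_def by auto
  then have "T < b" using assms(3) by (cases "T = b") auto
  then obtain a where a: "b = Suc a" "T \<le> a" by (cases b) auto
  have "\<not> Suc k \<le> cnt a w"
    using not_less_Least[of a "\<lambda>t. T \<le> t \<and> Suc k \<le> cnt t w"] a unfolding b_def[symmetric] by auto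
  then show ?thesis using a b by (intro exI[of _ a]) (auto simp: cnt_Suc split: if_splits)
qed

text \<open>Let \<open>a0 < p \<le> a1 < a2\<close> be consecutive effective visits of
  \<open>w\<close> around \<open>p = s m\<close>. The visit at \<open>a2\<close> certifies
  convergence beyond \<open>a1\<close>, in particular at \<open>Suc m\<close>, so
  \<open>s (Suc m) \<le> a2\<close>. Two applications of \<open>effective_interval\<close> bound the
  growth by \<open>6 / Suc k\<close>.\<close>

lemma fast_differences:
  assumes v: "live v" and L: "\<And>m. \<exists>t. m \<le> L (depth v) t"
    and s: "strict_mono s" "\<And>j t. j < L (depth v) t \<Longrightarrow> s j \<le> t"
    and T: "stable T (2 * v)" and N: "T \<le> N" "8 * 2 ^ n + cnt T (2 * v) \<le> cnt N (2 * v)" and m: "N \<le> m"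
  shows "X (s (Suc m)) - X (s m) < 1 / 2 ^ n"
proof -
  define w where "w = 2 * v"
  have w: "live w" unfolding w_def by (rule live_even_child[OF v L])
  have v0: "0 < v" using v by (simp add: live_def)
  have Tw: "stable T w" using T by (simp add: w_def)
  define p where "p = s m"
  have p: "m \<le> p" unfolding p_def using s(1) by (rule strict_mono_imp_increasing)
  define k where "k = cnt p w - 1"
  \<comment> \<open>The factor 8 leaves a margin over the 6 obtained below; the summand
    \<open>cnt T w\<close> makes \<open>k\<close> at least the count at \<open>T\<close>, as
    \<open>effective_visit\<close> demands.\<close>
  have cp: "8 * 2 ^ n + cnt T w \<le> cnt p w"
    using cnt_mono[OF Tw N(1), of p] N p m by (simp add: w_def)
  then have k: "cnt p w = Suc k" "cnt T w \<le> k" "8 * 2 ^ n \<le> Suc k"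
  proof -
    have "1 \<le> (2::nat) ^ n" by simp
    then have "1 + cnt T w \<le> cnt p w" using cp by linarith
    then show "cnt p w = Suc k" "cnt T w \<le> k" by (auto simp: k_def)
    then show "8 * 2 ^ n \<le> Suc k" using cp by simp
  qed
  obtain a0 where a0: "T \<le> a0" "cur a0 = w" "eff a0" "cnt a0 w = k" using effective_visit[OF w Tw, of k] k by auto
  obtain a1 where a1: "T \<le> a1" "cur a1 = w" "eff a1" "cnt a1 w = Suc k" using effective_visit[OF w Tw, of "Suc k"] k by auto
  obtain a2 where a2: "T \<le> a2" "cur a2 = w" "eff a2" "cnt a2 w = Suc (Suc k)"
    using effective_visit[OF w Tw, of "Suc (Suc k)"] k by auto
  have "a0 < p" using cnt_mono[OF Tw, of p a0] a0 k N p m by (cases "a0 < p") auto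
  have "p \<le> a1"
  proof (rule ccontr)
    assume "\<not> p \<le> a1"
    then have "cnt (Suc a1) w \<le> cnt p w" using cnt_mono[OF Tw, of "Suc a1" p] a1 by simp
    then show False using a1 k by (simp add: cnt_Suc)
  qed
  have "a1 < a2" using cnt_mono[OF Tw, of a2 a1] a1 a2 by (cases "a1 < a2") auto
  have "Suc a1 \<le> lst a2 w" by (rule lst_ge_visit[OF Tw a1(1,2) \<open>a1 < a2\<close>])
  then have "Suc m < L (depth v) a2" using cur_even[of a2 v] a2(2) v0 p \<open>p \<le> a1\<close> by (simp add: w_def)
  then have "s (Suc m) \<le> a2" by (rule s(2))
  then have "X (s (Suc m)) - X (s m) \<le> X a2 - X a0"
    using monoD[OF X_mono, of "s (Suc m)" a2] monoD[OF X_mono, of a0 p] \<open>a0 < p\<close> by (simp add: p_def)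
  also have "X a2 \<le> X a1 + 3 / real (Suc (cnt a1 w))"
    by (rule effective_interval[OF Tw _ a1(1-3) \<open>a1 < a2\<close>]) (use a1 a2 v0 in \<open>auto simp: w_def\<close>)
  also have "X a1 \<le> X a0 + 3 / real (Suc (cnt a0 w))"
    by (rule effective_interval[OF Tw _ a0(1-3)]) (use a0 a1 v0 \<open>a0 < p\<close> \<open>p \<le> a1\<close> in \<open>auto simp: w_def\<close>)
  also have "X a0 + 3 / real (Suc (cnt a0 w)) + 3 / real (Suc (cnt a1 w)) - X a0 \<le> 6 / real (Suc k)"
  proof -
    have "3 / real (Suc (Suc k)) \<le> 3 / real (Suc k)" by (intro divide_left_mono) auto
    then show ?thesis using a0 a1 by (simp add: add_divide_distrib[symmetric] del: of_nat_Suc)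
  qed
  also have "\<dots> < 1 / 2 ^ n"
  proof -
    have "real (8 * 2 ^ n) \<le> real (Suc k)" using k(3) by (simp only: of_nat_le_iff)
    then have "8 * 2 ^ n \<le> real (Suc k)" by simp
    moreover have "6 * (2::real) ^ n < 8 * 2 ^ n" by simp
    ultimately have "6 * 2 ^ n < real (Suc k)" by linarith
    then show ?thesis by (simp add: field_simps del: of_nat_Suc)
  qed
  finally show ?thesis by simp
qed

end

section \<open>Computability of the construction\<close>

text \<open>From exponent \<open>w\<close> on the quotient is constantly 0, so the search for
  \<open>j\<close> is bounded.\<close>

lemma decidable_pre [rec_intros]:
  assumes "recursive A" "recursive B" shows "decidable (\<lambda>e. pre (A e) (B e))"
proof -
  have eq: "pre v w \<longleftrightarrow> (\<exists>j<Suc w. w div 2 ^ j = v)" for v w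
  proof
    assume "pre v w"
    then obtain j where j: "w div 2 ^ j = v" unfolding pre_def by blast
    have zero: "w div 2 ^ i = 0" if "w \<le> i" for i
      using less_exp[of i] that by (intro div_less) linarith
    show "\<exists>j<Suc w. w div 2 ^ j = v"
      using j zero[of j] zero[of w] by (cases "j < Suc w") auto
  qed (auto simp: pre_def)
  have "recursive (\<lambda>e. if \<exists>j<Suc (e 1). e 1 div 2 ^ j = e 0 then 1 else 0)" by (intro rec_intros)
  then have "recursive (\<lambda>e. if pre (e 0) (e 1) then 1 else 0)" by (simp only: eq)
  from recursive_comp2[where f = "\<lambda>v w. if pre v w then 1 else 0", OF this assms]
  show ?thesis by (simp only: decidable_def)
qed

lemma decidable_right_of [rec_intros]:
  assumes "recursive A" "recursive B" shows "decidable (\<lambda>e. right_of (A e) (B e))"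
proof -
  have eq: "right_of w y \<longleftrightarrow> (\<exists>b<Suc y. 0 < b \<and> even b \<and> pre b y \<and> pre (Suc b) w)" for w y
    unfolding right_of_def by (auto dest: pre_le simp: less_Suc_eq_le)
  have "recursive (\<lambda>e. if \<exists>b<Suc (e 1). 0 < b \<and> even b \<and> pre b (e 1) \<and> pre (Suc b) (e 0) then 1 else 0)"
    by (intro rec_intros)
  then have "recursive (\<lambda>e. if right_of (e 0) (e 1) then 1 else 0)" by (simp only: eq)
  from recursive_comp2[where f = "\<lambda>v w. if right_of v w then 1 else 0", OF this assms]
  show ?thesis by (simp only: decidable_def)
qed

lemma ex_div_power_le_1: "\<exists>d. v div 2 ^ d \<le> (1::nat)"
  by (rule exI[of _ v]) (simp add: div_less less_exp)

text \<open>The recursion on \<open>v div 2\<close> becomes a minimisation, to which the calculus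
  applies.\<close>

lemma depth_eq_Least: "depth v = (LEAST d. v div 2 ^ d \<le> 1)"
proof (induction v rule: less_induct)
  case (less v)
  show ?case
  proof (cases "v \<le> 1")
    case True
    then show ?thesis by (subst depth.simps) (simp add: Least_eq_0)
  next
    case False
    obtain d where "v div 2 ^ d \<le> 1" using ex_div_power_le_1 by blast
    then have "(LEAST d. v div 2 ^ d \<le> 1) = Suc (LEAST d. v div 2 ^ Suc d \<le> 1)"
      by (rule Least_Suc) (use False in simp)
    also have "\<dots> = Suc (LEAST d. (v div 2) div 2 ^ d \<le> 1)" by (simp only: power_Suc div_mult2_eq)
    also have "\<dots> = depth v" using less[of "v div 2"] False depth.simps[of v] by simp
    finally show ?thesis by simp
  qed
qed

lemma recursive_depth [rec_intros]:
  assumes "recursive A" shows "recursive (\<lambda>e. depth (A e))"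
proof -
  have "recursive (\<lambda>e. LEAST d. e 0 div 2 ^ d \<le> 1)"
    by (rule recursive_Least_decidable) (intro rec_intros, rule ex_div_power_le_1)
  then have "recursive (\<lambda>e. depth (e 0))" by (simp only: depth_eq_Least)
  from recursive_comp1[OF this assms] show ?thesis .
qed

text \<open>A stack of values together with its height, the last value on top; \<open>lookup\<close>
  pops down to the wanted one. It codes the finitely supported components of a state.\<close>

definition table :: "nat \<Rightarrow> (nat \<Rightarrow> nat) \<Rightarrow> nat" where
  "table n f = prod_encode (n, rec_nat 0 (\<lambda>i s. Suc (prod_encode (f i, s))) n)"

definition lookup :: "nat \<Rightarrow> nat \<Rightarrow> nat" where
  "lookup z v = (if v < fst (prod_decode z) then
     fst (prod_decode (rec_nat (snd (prod_decode z)) (\<lambda>_ s. snd (prod_decode (s - 1)))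
       (fst (prod_decode z) - Suc v) - 1)) else 0)"

lemma lookup_table: "lookup (table n f) v = (if v < n then f v else 0)"
proof -
  let ?tab = "rec_nat 0 (\<lambda>i s. Suc (prod_encode (f i, s)))"
  have "rec_nat (?tab (m + j)) (\<lambda>_ s. snd (prod_decode (s - 1))) j = ?tab m" for m j
  proof (induction j arbitrary: m)
    case (Suc j)
    show ?case using Suc[of "Suc m"] by simp
  qed simp
  note tl = this
  show ?thesis
  proof (cases "v < n")
    case True
    then obtain j where j: "n = Suc v + j" by (metis less_iff_Suc_add add_Suc)
    have "rec_nat (?tab n) (\<lambda>_ s. snd (prod_decode (s - 1))) (n - Suc v) = ?tab (Suc v)"
      using tl[of "Suc v" j] unfolding j by (simp only: diff_add_inverse)
    then show ?thesis using True by (simp add: lookup_def table_def)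
  qed (simp add: lookup_def table_def)
qed

lemma recursive_table [rec_intros]:
  assumes "recursive N" "recursive (\<lambda>e. F (e 0) (\<lambda>j. e (Suc j)))"
  shows "recursive (\<lambda>e. table (N e) (\<lambda>i. F i e))"
proof -
  have "recursive (\<lambda>e. Suc (prod_encode (F (e 1) (\<lambda>j. e (Suc (Suc j))), e 0)))"
    using recursive_subst[OF assms(2), of "\<lambda>i e. e (Suc i)"]
    by (intro rec_intros) (auto simp: recursive_var)
  from recursive_rec_nat[where G = "\<lambda>n y e. Suc (prod_encode (F n e, y))", OF assms(1) recursive_const[of 0] this]
  show ?thesis unfolding table_def by (rule recursive_prod_encode[OF assms(1)])
qed

lemma recursive_lookup [rec_intros]:
  assumes "recursive A" "recursive B" shows "recursive (\<lambda>e. lookup (A e) (B e))"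
proof (rule recursive_comp2[OF _ assms])
  have "recursive (\<lambda>e. rec_nat (snd (prod_decode (e 0))) (\<lambda>_ s. snd (prod_decode (s - 1)))
       (fst (prod_decode (e 0)) - Suc (e 1)))"
    by (rule recursive_rec_nat[where G = "\<lambda>_ s _. snd (prod_decode (s - 1))"]) (intro rec_intros)+
  then show "recursive (\<lambda>e. lookup (e 0) (e 1))" unfolding lookup_def by (intro rec_intros)
qed

definition dec_cur :: "nat \<Rightarrow> nat" where
  "dec_cur s = fst (prod_decode s)"
definition dec_res :: "nat \<Rightarrow> nat \<Rightarrow> nat" where
  "dec_res s = lookup (fst (prod_decode (snd (prod_decode s))))"
definition dec_cnt :: "nat \<Rightarrow> nat \<Rightarrow> nat" where
  "dec_cnt s = lookup (fst (prod_decode (snd (prod_decode (snd (prod_decode s))))))"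
definition dec_lst :: "nat \<Rightarrow> nat \<Rightarrow> nat" where
  "dec_lst s = lookup (snd (prod_decode (snd (prod_decode (snd (prod_decode s))))))"

definition next_code :: "(nat \<Rightarrow> nat \<Rightarrow> nat) \<Rightarrow> nat \<Rightarrow> nat \<Rightarrow> nat" where
  "next_code L t s = prod_encode (next_cur L t (dec_cur s) (dec_lst s), prod_encode (
     table (t + 3) (\<lambda>v. next_res t (dec_cur s) (dec_res s) (dec_cnt s) (dec_lst s) v), prod_encode (
     table (t + 3) (\<lambda>v. next_cnt t (dec_cur s) (dec_res s) (dec_cnt s) (dec_lst s) v),
     table (t + 3) (\<lambda>v. next_lst t (dec_cur s) (dec_lst s) v))))"

lemma recursive_next_code:
  assumes L: "recursive (\<lambda>e. L (e 0) (e 1))"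
  shows "recursive (\<lambda>e. next_code L (e 0) (e 1))"
proof -
  note L' = recursive_comp2[where f = L, OF L]
  note defs = dec_cur_def dec_res_def dec_cnt_def dec_lst_def
    next_res_def next_cnt_def next_lst_def released_def effective_def pending_def
  have res: "recursive (\<lambda>e. next_res (e 0) (dec_cur (e 1)) (dec_res (e 1)) (dec_cnt (e 1)) (dec_lst (e 1)) (e 2))"
    unfolding defs by (intro rec_intros)
  have cnt: "recursive (\<lambda>e. next_cnt (e 0) (dec_cur (e 1)) (dec_res (e 1)) (dec_cnt (e 1)) (dec_lst (e 1)) (e 2))"
    unfolding defs by (intro rec_intros)
  have lst: "recursive (\<lambda>e. next_lst (e 0) (dec_cur (e 1)) (dec_lst (e 1)) (e 2))"
    unfolding defs by (intro rec_intros)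
  have cur: "recursive (\<lambda>e. next_cur L (e 0) (dec_cur (e 1)) (dec_lst (e 1)))"
    unfolding next_cur_def next_child_def defs by (intro rec_intros L')
  show ?thesis unfolding next_code_def
    by (intro rec_intros cur
        recursive_comp3[where f = "\<lambda>t s. next_res t (dec_cur s) (dec_res s) (dec_cnt s) (dec_lst s)", OF res]
        recursive_comp3[where f = "\<lambda>t s. next_cnt t (dec_cur s) (dec_res s) (dec_cnt s) (dec_lst s)", OF cnt]
        recursive_comp3[where f = "\<lambda>t s. next_lst t (dec_cur s) (dec_lst s)", OF lst])
qed

context tree_construction
begin

text \<open>Only nodes up to \<open>Suc t\<close> are visited by time \<open>t\<close>, so tables of
  length \<open>t + 2\<close> represent the state exactly.\<close>

lemma state_support: "t + 2 \<le> v \<Longrightarrow> res t v = 0 \<and> cnt t v = 0 \<and> lst t v = 0"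
proof (induction t)
  case (Suc t)
  then have "v \<noteq> cur t" "v \<noteq> cur t div 2" using cur_le[of t] by auto
  then show ?case using Suc by (simp add: state_Suc(2) next_res_def cnt_Suc lst_Suc)
qed simp

definition state_code :: "nat \<Rightarrow> nat" where
  "state_code t = prod_encode (cur t, prod_encode (table (t + 2) (res t),
     prod_encode (table (t + 2) (cnt t), table (t + 2) (lst t))))"

lemma dec_state_code:
  "dec_cur (state_code t) = cur t" "dec_res (state_code t) = res t"
  "dec_cnt (state_code t) = cnt t" "dec_lst (state_code t) = lst t"
  using state_support[of t]
  by (auto simp: dec_cur_def dec_res_def dec_cnt_def dec_lst_def state_code_def lookup_table)

lemma state_code_eq: "state_code t = rec_nat (state_code 0) (next_code L) t"
proof (induction t)
  case (Suc t)
  have "state_code (Suc t) = next_code L t (state_code t)"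
    unfolding next_code_def dec_state_code
    by (simp add: state_code_def state_Suc numeral_3_eq_3)
  then show ?case using Suc by simp
qed simp

lemma recursive_state_code:
  assumes L: "recursive (\<lambda>e. L (e 0) (e 1))" and A: "recursive A"
  shows "recursive (\<lambda>e. state_code (A e))"
  by (subst state_code_eq, rule recursive_rec_nat[where G = "\<lambda>t s _. next_code L t s"])
    (intro A rec_intros recursive_comp2[where f = "next_code L", OF recursive_next_code[OF L]])+

lemma recursive_res:
  assumes "recursive (\<lambda>e. L (e 0) (e 1))" "recursive A" "recursive B"
  shows "recursive (\<lambda>e. res (A e) (B e))"
  unfolding dec_state_code(2)[symmetric] dec_res_def
  by (intro rec_intros recursive_state_code assms)

lemma recursive_cnt:
  assumes "recursive (\<lambda>e. L (e 0) (e 1))" "recursive A" "recursive B"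
  shows "recursive (\<lambda>e. cnt (A e) (B e))"
  unfolding dec_state_code(3)[symmetric] dec_cnt_def
  by (intro rec_intros recursive_state_code assms)

end

section \<open>The real built from the convergence lengths of all programs\<close>

interpretation tree_construction conv_length
  by unfold_locales (rule conv_length_mono)

lemmas recursive_conv_length_var = recursive_conv_length[OF recursive_var recursive_var]

lemmas recursive_conv_res [rec_intros] = recursive_res[OF recursive_conv_length_var]
lemmas recursive_conv_cnt [rec_intros] = recursive_cnt[OF recursive_conv_length_var]

definition Xq :: "nat \<Rightarrow> rat" where "Xq t = of_nat (res t 0) / of_nat (2 ^ t)"

lemma of_rat_Xq: "real_of_rat (Xq t) = X t"
  by (simp add: Xq_def X_def R_def of_rat_divide of_rat_power)

lemma computable_Xq: "computable_rat_seq Xq"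
  unfolding computable_rat_seq_def
proof (intro exI conjI allI)
  show "computable (\<lambda>t. res t 0)" "computable (\<lambda>_. 0)" "computable (\<lambda>t. 2 ^ t - 1)"
    unfolding computable_iff_recursive by (intro rec_intros)+
  fix t
  have "Suc (2 ^ t - 1) = 2 ^ t" by simp
  then show "Xq t = (of_nat (res t 0) - of_nat 0) / of_nat (Suc (2 ^ t - 1))"
    by (simp only: Xq_def of_nat_0 diff_zero)
qed

lemma Xq_tendsto: "(\<lambda>t. real_of_rat (Xq t)) \<longlonglongrightarrow> x_lim"
  unfolding of_rat_Xq by (rule X_tendsto)

lemma left_computable_x: "left_computable x_lim"
  unfolding left_computable_def
proof (intro exI conjI)
  show "mono Xq"
    using X_mono by (simp add: mono_def flip: of_rat_Xq) (simp add: of_rat_less_eq)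
qed (rule computable_Xq Xq_tendsto)+

text \<open>The index of a program is the depth at which its totality is guessed, and the true path
  has a node at every depth.\<close>

lemma live_node_of_computable:
  assumes "computable g"
  obtains v where "live v" "\<And>t j. j < conv_length (depth v) t \<Longrightarrow> g j \<le> t"
    "\<And>m. \<exists>t. m \<le> conv_length (depth v) t"
proof -
  obtain i where "\<And>t j. j < conv_length i t \<Longrightarrow> g j \<le> t" "\<And>m. \<exists>t. m \<le> conv_length i t"
    using conv_length_universal[OF assms] by blast
  moreover obtain v where "live v" "depth v = i" using live_at_depth by blast
  ultimately show ?thesis using that by blast
qed

lemma nearly_computable_x: "nearly_computable x_lim"
  unfolding nearly_computable_def converges_nearly_computably_def
proof (intro exI[of _ Xq] conjI allI impI computable_Xq Xq_tendsto)
  show "convergent (\<lambda>n. real_of_rat (Xq n))" using Xq_tendsto by (rule convergentI)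
  fix s assume s: "computable s \<and> strict_mono s"
  obtain v where v: "live v" "\<And>t j. j < conv_length (depth v) t \<Longrightarrow> s j \<le> t"
    "\<And>m. \<exists>t. m \<le> conv_length (depth v) t"
    using live_node_of_computable s by blast
  have w: "live (2 * v)" using live_even_child[OF v(1,3)] .
  then obtain T where T: "stable T (2 * v)" unfolding live_def by blast
  \<comment> \<open>\<open>v\<close> and \<open>T\<close> enter as constants, obtained
    non-effectively; given these, the search for a time with a large enough count is
    computable.\<close>
  define N where "N n = (LEAST t. T \<le> t \<and> 8 * 2 ^ n + cnt T (2 * v) \<le> cnt t (2 * v))" for n
  have ex: "\<exists>t. T \<le> t \<and> 8 * 2 ^ n + cnt T (2 * v) \<le> cnt t (2 * v)" for n
    using live_cnt_unbounded[OF w T] by blast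
  have "computable N"
    unfolding computable_iff_recursive N_def
    by (rule recursive_Least_decidable) (intro rec_intros, rule ex)
  have mod: "is_modulus (\<lambda>n. X (s (Suc n)) - X (s n)) 0 N"
    unfolding is_modulus_def
  proof (intro allI impI)
    fix n m assume m: "N n \<le> m"
    have "X (s (Suc m)) - X (s m) < 1 / 2 ^ n"
      by (rule fast_differences[OF v(1,3) conjunct2[OF s] v(2) T _ _ m])
        (use LeastI_ex[OF ex[of n]] in \<open>auto simp: N_def\<close>)
    moreover have "X (s m) \<le> X (s (Suc m))"
      using s by (intro monoD[OF X_mono]) (simp add: strict_mono_less_eq)
    ultimately show "\<bar>0 - (X (s (Suc m)) - X (s m))\<bar> < 1 / 2 ^ n" by simp
  qed
  have "(\<lambda>n. X (s (Suc n)) - X (s n)) \<longlonglongrightarrow> x_lim - x_lim"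
    using s LIMSEQ_subseq_LIMSEQ[OF X_tendsto, of s]
    by (intro tendsto_diff) (auto simp: comp_def intro: LIMSEQ_Suc)
  then show "converges_computably_to (\<lambda>n. real_of_rat (Xq (s (Suc n))) - real_of_rat (Xq (s n))) 0"
    unfolding converges_computably_to_def of_rat_Xq using mod \<open>computable N\<close> by auto
qed

text \<open>An approximation \<open>q\<close> yields the computable time \<open>f n\<close> at which
  \<open>X\<close> overtakes \<open>q n - 1 / 2 ^ n\<close>. If \<open>q n\<close> is within
  \<open>1 / 2 ^ n\<close> of the limit, then \<open>X\<close> is within \<open>2 / 2 ^ n\<close>
  from \<open>f n\<close> on, which \<open>slow_convergence\<close> refutes for almost all
  \<open>n\<close>.\<close>

lemma not_regainingly_approximable_x: "\<not> regainingly_approximable x_lim"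
proof
  assume "regainingly_approximable x_lim"
  then obtain q where q: "computable_rat_seq q" "mono q" "(\<lambda>n. real_of_rat (q n)) \<longlonglongrightarrow> x_lim"
    and inf: "infinite {n. x_lim - real_of_rat (q n) < 1 / 2 ^ n}"
    unfolding regainingly_approximable_def by blast
  obtain a b c where abc: "computable a" "computable b" "computable c"
    and q_eq: "\<And>n. q n = (of_nat (a n) - of_nat (b n)) / of_nat (Suc (c n))"
    using q(1) unfolding computable_rat_seq_def by blast
  \<comment> \<open>Clearing denominators and moving negative terms across leaves natural numbers on
    both sides, so the calculus decides the comparison.\<close>
  have less_iff: "real_of_rat (q n) - 1 / 2 ^ n < X t \<longleftrightarrow>
      a n * 2 ^ n * 2 ^ t < b n * 2 ^ n * 2 ^ t + Suc (c n) * 2 ^ t + res t 0 * Suc (c n) * 2 ^ n" (is "_ \<longleftrightarrow> ?A < ?B") for n t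
  proof -
    have "real_of_rat (q n) = (real (a n) - real (b n)) / real (Suc (c n))"
      unfolding q_eq by (simp add: of_rat_divide of_rat_diff of_rat_add)
    then have "real_of_rat (q n) - 1 / 2 ^ n < X t \<longleftrightarrow>
        (real (a n) - real (b n)) / real (Suc (c n)) - 1 / 2 ^ n < real (res t 0) / 2 ^ t"
      by (simp add: X_def R_def)
    also have "\<dots> \<longleftrightarrow> real ?A < real ?B"
      by (simp add: field_simps del: of_nat_Suc mult_Suc mult_Suc_right)
    finally show ?thesis by (simp only: of_nat_less_iff)
  qed
  have q_le: "real_of_rat (q n) \<le> x_lim" for n
  proof (rule LIMSEQ_le_const[OF q(3)])
    show "\<exists>N. \<forall>m\<ge>N. real_of_rat (q n) \<le> real_of_rat (q m)"
      by (intro exI[of _ n] allI impI) (simp add: of_rat_less_eq monoD[OF q(2)])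
  qed
  have ex: "\<exists>t. real_of_rat (q n) - 1 / 2 ^ n < X t" for n
  proof -
    have "0 < (1 / 2 ^ n :: real)" by simp
    then have "real_of_rat (q n) - 1 / 2 ^ n < x_lim" using q_le[of n] by linarith
    from order_tendstoD(1)[OF X_tendsto this] show ?thesis by (auto simp: eventually_sequentially)
  qed
  define f where "f n = (LEAST t. real_of_rat (q n) - 1 / 2 ^ n < X t)" for n
  have "recursive (\<lambda>e. LEAST t. real_of_rat (q (e 0)) - 1 / 2 ^ e 0 < X t)"
  proof (rule recursive_Least_decidable)
    show "decidable (\<lambda>e. real_of_rat (q (e (Suc 0))) - 1 / 2 ^ e (Suc 0) < X (e 0))"
      unfolding less_iff
      by (intro rec_intros recursive_computable[OF abc(1)] recursive_computable[OF abc(2)]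
          recursive_computable[OF abc(3)])
  qed (rule ex)
  then have "computable f" unfolding computable_iff_recursive f_def .
  then obtain v where v: "live v" "\<And>t j. j < conv_length (depth v) t \<Longrightarrow> f j \<le> t"
    "\<And>m. \<exists>t. m \<le> conv_length (depth v) t"
    using live_node_of_computable by blast
  obtain n0 where n0: "\<And>n. n0 \<le> n \<Longrightarrow> \<exists>t. n < conv_length (depth v) t \<and> 2 / 2 ^ n \<le> x_lim - X t"
    using slow_convergence[OF v(1,3)] by blast
  obtain n where n: "n0 \<le> n" "x_lim - real_of_rat (q n) < 1 / 2 ^ n"
    using inf unfolding infinite_nat_iff_unbounded_le by blast
  obtain t where t: "n < conv_length (depth v) t" "2 / 2 ^ n \<le> x_lim - X t" using n0[OF n(1)] by blast
  have "real_of_rat (q n) - 1 / 2 ^ n < X (f n)" unfolding f_def by (rule LeastI_ex[OF ex])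
  also have "X (f n) \<le> X t" by (rule monoD[OF X_mono v(2)[OF t(1)]])
  finally have "x_lim - X t < 1 / 2 ^ n + 1 / 2 ^ n" using n(2) by linarith
  then show False using t(2) by simp
qed

theorem theorem3p2:
  shows "\<exists>x::real. left_computable x \<and> nearly_computable x \<and> \<not> regainingly_approximable x"
  using left_computable_x nearly_computable_x not_regainingly_approximable_x by blast

end
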